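(* Let $f(\varphi)=\frac1{|Q|}\sum_{q\in Q}\|(A_q\pi_q(\varphi)+b_q)_+\|_2^2$, $\varphi\in\mathbb{R}^m$, be the supervised PageRank learning objective described in the context. Assume that the point $\varphi_0$ lies in the vicinity of the local minimum point $\varphi^*$ of the function $f$ and that $f$ is convex in this vicinity. Let the two-level method described in the context be run from $\varphi_0$ with accuracy $\varepsilon>0$ and with the parameters $L,R,r,b$ described there, and let $\hat\varphi_M$ be its output. Then the mean total number of arithmetic operations for the accuracy $\varepsilon$, i.e. for the inequality $$\mathbb{E}_{\mathcal{U}_{M-1}}f(\hat\varphi_M)-f(\varphi^* )\le\varepsilon$$ to hold, is given by $$64\,m\,p\,s\,|Q|\,\frac{LR^2}{\alpha\varepsilon}\,\ln\left(4\big(2r+b\sqrt{2r}\big)\frac{32mR\sqrt{L(m+8)}}{\varepsilon^{3/2}\sqrt2}\right).$$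
   Context: **Random walk model.** $Q$ is a finite set of queries. For each $q\in Q$, $\Gamma_q=(V_q,E_q)$ is a finite directed graph with $p_q$ vertices; $F_q(\varphi_1,\cdot):V_q\to\mathbb{R}$ and $G_q(\varphi_2,\cdot):E_q\to\mathbb{R}$ are weights of vertices and edges parameterized by $\varphi=(\varphi_1,\varphi_2)\in\mathbb{R}^{m_1}\times\mathbb{R}^{m_2}=\mathbb{R}^m$, $m=m_1+m_2$. The seed set $S_q\subset V_q$ is the set of vertices $i$ with $F_q(\varphi_1,i)\ne0$ for some $\varphi_1$. Every vertex of $V_q$ is in $S_q$ or is reachable from a vertex of $S_q$ by a path whose edges have non-zero weight $G_q(\varphi_2,\cdot)$ for some $\varphi$, and every edge of $E_q$ has non-zero weight $G_q(\varphi_2,\cdot)$ for some $\varphi_2$. The restart probabilities are $[\pi_q^0(\varphi)]_i=F_q(\varphi_1,i)/\sum_{\tilde i\in S_q}F_q(\varphi_1,\tilde i)$ for $i\in S_q$ and $0$ otherwise; the transition probabilities are $[P_q(\varphi)]_{\tilde i,i}=G_q(\varphi_2,\tilde i\to i)/\sum_{j:\tilde i\to j}G_q(\varphi_2,\tilde i\to j)$ for $\tilde i\to i\in E_q$ and $0$ otherwise (these are understood to be probabilities). With damping factor $\alpha\in(0,1)$, $\pi_q(\varphi)\in\mathbb{R}^{p_q}$ is the stationary distribution of the resulting Markov process, i.e. the solution of $\pi_q=\alpha\pi_q^0(\varphi)+(1-\alpha)P_q^T(\varphi)\pi_q$. **Objective.** For each $q$, some vertices of $V_q$ are judged and grouped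 by relevance label into sets $W_q^1,\dots,W_q^k$ ($W_q^1$ being the most relevant). For margins $b_{j_1j_2}>0$, $1\le j_2<j_1\le k$, let $h(j_1,j_2,x)=(\min\{x+b_{j_1j_2},0\})^2$ and $$f(\varphi)=\frac1{|Q|}\sum_{q\in Q}\ \sum_{1\le j_2<j_1\le k}\ \sum_{i_1\in W_q^{j_1},\,i_2\in W_q^{j_2}}h\big(j_1,j_2,[\pi_q(\varphi)]_{i_2}-[\pi_q(\varphi)]_{i_1}\big).$$ Equivalently $f(\varphi)=\frac1{|Q|}\sum_{q}\|(A_q\pi_q(\varphi)+b_q)_+\|_2^2$, where $[x_+]_i=\max\{x_i,0\}$, $A_q\in\mathbb{R}^{r_q\times p_q}$ has one row per summand (with entry $1$ in column $i_1$, $-1$ in column $i_2$, and $0$ elsewhere), $b_q\in\mathbb{R}^{r_q}$ has corresponding entry $-b_{j_1j_2}$, and $r_q$ is the number of summands for $q$. Put $r=\max_qr_q$, $b=\max_q\|b_q\|_2$, $p=\max_qp_q$, and $s=\max_qs_q$, where $s_q$ is the maximum number of non-zero elements over columns of $P_q(\varphi)$. **Parameters.** $L>0$ is the Lipschitz constant for $f$, in the sense that the gradient of $f$ is $L$-Lipschitz: $|f(x)-f(y)-\langle\nabla f(y),x-y\rangle|\le\frac L2\|x-y\|_2^2$. $R>0$ is a radius with $\|\varphi_0-\varphi^*\|_2\le R$. **Inner approximation.** $\tilde\pi_q^N(\varphi)=\frac{\alpha}{1-(1-\alpha)^{N+1}}\sum_{i=0}^N(1-\alpha)^i[P_q^T(\varphi)]^i\pi_q^0(\varphi)$,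 and $f^\delta(\varphi)=\frac1{|Q|}\sum_q\|(A_q\tilde\pi_q^N(\varphi)+b_q)_+\|_2^2$. **Method.** Input: $\varphi_0$, $L$, $R$, $\varepsilon$, $r$, $b$. Set $X=\{\varphi\in\mathbb{R}^m:\|\varphi-\varphi_0\|_2\le2R\}$, $M=32m\frac{LR^2}{\varepsilon}$, $\delta=\frac{\varepsilon^{3/2}\sqrt2}{32mR\sqrt{L(m+8)}}$, $\mu=\sqrt{\frac{2\varepsilon}{L(m+8)}}$, $N=\frac1\alpha\ln\frac{2\sqrt{2r}(2\sqrt{2r}+2b)}{\delta}$ ($M$ and $N$ are understood as rounded up to integers when running the method). Starting from $k=0$, repeat until $k>M$: draw $s_k$ uniformly distributed on the unit Euclidean sphere of $\mathbb{R}^m$; compute $\tilde\pi_q^N(\varphi_k)$ and $\tilde\pi_q^N(\varphi_k+\mu s_k)$ for all $q\in Q$; set $g_\mu^\delta(\varphi_k)=\frac m\mu\big(f^\delta(\varphi_k+\mu s_k)-f^\delta(\varphi_k)\big)s_k$ and $\varphi_{k+1}=\Pi_X\big(\varphi_k-\frac1{8mL}g_\mu^\delta(\varphi_k)\big)$, where $\Pi_X$ is Euclidean projection onto $X$; increase $k$ by one. The output is $\hat\varphi_M=\arg\min_\varphi\{f(\varphi):\varphi\in\{\varphi_0,\dots,\varphi_M\}\}$. $\mathcal{U}_{M-1}=(s_0,\dots,s_{M-1})$ is the history of the random vectors, and $\mathbb{E}_{\mathcal{U}_{M-1}}$ is expectation over it. **Operation count.** Only the dominant cost, the computation of the vectors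 $\tilde\pi_q^N$, is counted: one multiplication of $P_q^T(\varphi)$ by a vector costs $s_qp_q\le sp$ arithmetic operations, one vector $\tilde\pi_q^N$ needs $N$ such multiplications, and each iteration computes $2|Q|$ such vectors. Hence one iteration is counted as approximately $\frac{2|Q|sp}{\alpha}\ln\frac{2\sqrt{2r}(2\sqrt{2r}+2b)}{\delta}$ operations; the rounding of $M$ and $N$ is ignored.
   Formalization: The vicinity is taken to be a ball around φ* on which f is convex and which contains every point the method may evaluate, i.e. the ball of radius 2R+μ around φ0 (not only φ0 itself); the weights are assumed Borel measurable in φ. *)

theory Defs
  imports "HOL-Probability.Probability"
begin

record ('q, 'v, 'a, 'b) pagerank_problem =
  queries :: "'q set"
  vertices :: "'q \<Rightarrow> 'v set"
  edges :: "'q \<Rightarrow> ('v \<times> 'v) set"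
  vertex_weight :: "'q \<Rightarrow> 'a \<Rightarrow> 'v \<Rightarrow> real"
  edge_weight :: "'q \<Rightarrow> 'b \<Rightarrow> 'v \<times> 'v \<Rightarrow> real"
  damping :: real
  label_count :: nat
  judged :: "'q \<Rightarrow> nat \<Rightarrow> 'v set"
  margin :: "nat \<Rightarrow> nat \<Rightarrow> real"

text \<open>Vectors indexed by the vertices of a graph are functions on \<open>'v\<close> that vanish outside
  the vertex set. A parameter is a pair: the first component enters the vertex weights, the second
  one the edge weights.\<close>

definition seeds :: "('q, 'v, 'a, 'b) pagerank_problem \<Rightarrow> 'q \<Rightarrow> 'v set" where
  "seeds I q = {i \<in> vertices I q. \<exists>x. vertex_weight I q x i \<noteq> 0}"

definition restart :: "('q, 'v, 'a, 'b) pagerank_problem \<Rightarrow> 'q \<Rightarrow> 'a \<times> 'b \<Rightarrow> 'v \<Rightarrow> real" where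
  "restart I q \<phi> i =
     (if i \<in> seeds I q
      then vertex_weight I q (fst \<phi>) i / (\<Sum>i'\<in>seeds I q. vertex_weight I q (fst \<phi>) i')
      else 0)"

definition transition ::
  "('q, 'v, 'a, 'b) pagerank_problem \<Rightarrow> 'q \<Rightarrow> 'a \<times> 'b \<Rightarrow> 'v \<Rightarrow> 'v \<Rightarrow> real" where
  "transition I q \<phi> i' i =
     (if (i', i) \<in> edges I q
      then edge_weight I q (snd \<phi>) (i', i)
             / (\<Sum>j | (i', j) \<in> edges I q. edge_weight I q (snd \<phi>) (i', j))
      else 0)"

definition transition_transpose ::
  "('q, 'v, 'a, 'b) pagerank_problem \<Rightarrow> 'q \<Rightarrow> 'a \<times> 'b \<Rightarrow> ('v \<Rightarrow> real) \<Rightarrow> 'v \<Rightarrow> real" where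
  "transition_transpose I q \<phi> x i = (\<Sum>i'\<in>vertices I q. transition I q \<phi> i' i * x i')"

definition pagerank :: "('q, 'v, 'a, 'b) pagerank_problem \<Rightarrow> 'q \<Rightarrow> 'a \<times> 'b \<Rightarrow> 'v \<Rightarrow> real" where
  "pagerank I q \<phi> =
     (THE x. (\<forall>i. i \<notin> vertices I q \<longrightarrow> x i = 0) \<and>
             (\<forall>i\<in>vertices I q. x i = damping I * restart I q \<phi> i
                                 + (1 - damping I) * transition_transpose I q \<phi> x i))"

text \<open>The weights have to turn into probabilities for every parameter. Vertices without
  out-edges are allowed; their rows of the transition matrix are zero.\<close>

definition pagerank_model :: "('q, 'v, 'a, 'b) pagerank_problem \<Rightarrow> bool" where
  "pagerank_model I \<longleftrightarrow>
     finite (queries I) \<and> queries I \<noteq> {} \<and> 0 < damping I \<and> damping I < 1 \<and>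
     (\<forall>q\<in>queries I.
        finite (vertices I q) \<and>
        edges I q \<subseteq> vertices I q \<times> vertices I q \<and>
        (\<forall>e\<in>edges I q. \<exists>y. edge_weight I q y e \<noteq> 0) \<and>
        (\<forall>i\<in>vertices I q. \<exists>i0\<in>seeds I q.
           (i0, i) \<in> {e \<in> edges I q. \<exists>y. edge_weight I q y e \<noteq> 0}\<^sup>*) \<and>
        (\<forall>\<phi>. (\<forall>i\<in>vertices I q. 0 \<le> restart I q \<phi> i) \<and>
             (\<Sum>i\<in>vertices I q. restart I q \<phi> i) = 1 \<and>
             (\<forall>i'\<in>vertices I q. \<forall>i\<in>vertices I q. 0 \<le> transition I q \<phi> i' i) \<and>
             (\<forall>i'\<in>vertices I q. (\<exists>i. (i', i) \<in> edges I q) \<longrightarrow>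
                (\<Sum>i\<in>vertices I q. transition I q \<phi> i' i) = 1)))"

definition judgement_model :: "('q, 'v, 'a, 'b) pagerank_problem \<Rightarrow> bool" where
  "judgement_model I \<longleftrightarrow>
     (\<forall>q\<in>queries I. \<forall>j\<in>{1..label_count I}. judged I q j \<subseteq> vertices I q) \<and>
     (\<forall>q\<in>queries I. disjoint_family_on (judged I q) {1..label_count I}) \<and>
     (\<forall>j1\<in>{1..label_count I}. \<forall>j2\<in>{1..<j1}. 0 < margin I j1 j2)"

definition measurable_weights ::
  "('q, 'v, 'a :: topological_space, 'b :: topological_space) pagerank_problem \<Rightarrow> bool" where
  "measurable_weights I \<longleftrightarrow>
     (\<forall>q\<in>queries I.
        (\<forall>i\<in>vertices I q. (\<lambda>x. vertex_weight I q x i) \<in> borel_measurable borel) \<and>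
        (\<forall>e\<in>edges I q. (\<lambda>y. edge_weight I q y e) \<in> borel_measurable borel))"


text \<open>The rows of the matrix of a query are indexed by the tuples \<open>(j1, j2, i1, i2)\<close> over which
  the loss is summed.\<close>

definition loss_rows :: "('q, 'v, 'a, 'b) pagerank_problem \<Rightarrow> 'q \<Rightarrow> (nat \<times> nat \<times> 'v \<times> 'v) set" where
  "loss_rows I q = {(j1, j2, i1, i2). 1 \<le> j2 \<and> j2 < j1 \<and> j1 \<le> label_count I \<and>
                                      i1 \<in> judged I q j1 \<and> i2 \<in> judged I q j2}"

definition row_matrix :: "nat \<times> nat \<times> 'v \<times> 'v \<Rightarrow> 'v \<Rightarrow> real" where
  "row_matrix = (\<lambda>(j1, j2, i1, i2) i. if i = i1 then 1 else if i = i2 then - 1 else 0)"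

definition row_offset ::
  "('q, 'v, 'a, 'b) pagerank_problem \<Rightarrow> nat \<times> nat \<times> 'v \<times> 'v \<Rightarrow> real" where
  "row_offset I = (\<lambda>(j1, j2, i1, i2). - margin I j1 j2)"

definition loss :: "('q, 'v, 'a, 'b) pagerank_problem \<Rightarrow> ('q \<Rightarrow> 'v \<Rightarrow> real) \<Rightarrow> real" where
  "loss I \<pi> =
     1 / real (card (queries I)) *
     (\<Sum>q\<in>queries I.
        (L2_set (\<lambda>\<rho>. max ((\<Sum>i\<in>vertices I q. row_matrix \<rho> i * \<pi> q i) + row_offset I \<rho>) 0)
           (loss_rows I q))\<^sup>2)"

definition objective :: "('q, 'v, 'a, 'b) pagerank_problem \<Rightarrow> 'a \<times> 'b \<Rightarrow> real" where
  "objective I \<phi> = loss I (\<lambda>q. pagerank I q \<phi>)"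

definition hinge :: "('q, 'v, 'a, 'b) pagerank_problem \<Rightarrow> nat \<Rightarrow> nat \<Rightarrow> real \<Rightarrow> real" where
  "hinge I j1 j2 x = (min (x + margin I j1 j2) 0)\<^sup>2"

lemma objective_eq_sum_hinge:
  assumes "pagerank_model I" "judgement_model I"
  shows "objective I \<phi> = 1 / real (card (queries I)) *
           (\<Sum>q\<in>queries I. \<Sum>(j1, j2, i1, i2)\<in>loss_rows I q.
              hinge I j1 j2 (pagerank I q \<phi> i2 - pagerank I q \<phi> i1))"
proof -
  have "(L2_set (\<lambda>\<rho>. max ((\<Sum>i\<in>vertices I q. row_matrix \<rho> i * pagerank I q \<phi> i) + row_offset I \<rho>) 0)
           (loss_rows I q))\<^sup>2
        = (\<Sum>(j1, j2, i1, i2)\<in>loss_rows I q. hinge I j1 j2 (pagerank I q \<phi> i2 - pagerank I q \<phi> i1))"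
    if q: "q \<in> queries I" for q
  proof -
    have fin: "finite (vertices I q)"
      using assms q by (auto simp: pagerank_model_def)
    have entry: "(max ((\<Sum>i\<in>vertices I q. row_matrix \<rho> i * pagerank I q \<phi> i) + row_offset I \<rho>) 0)\<^sup>2
        = (case \<rho> of (j1, j2, i1, i2) \<Rightarrow>
             hinge I j1 j2 (pagerank I q \<phi> i2 - pagerank I q \<phi> i1))"
      if "\<rho> \<in> loss_rows I q" for \<rho>
    proof -
      obtain j1 j2 i1 i2 where \<rho>: "\<rho> = (j1, j2, i1, i2)"
        by (metis prod_cases4)
      have j: "j1 \<in> {1..label_count I}" "j2 \<in> {1..label_count I}" "j1 \<noteq> j2"
        and i: "i1 \<in> judged I q j1" "i2 \<in> judged I q j2"
        using that by (auto simp: \<rho> loss_rows_def)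
      have V: "i1 \<in> vertices I q" "i2 \<in> vertices I q"
        using j i assms(2) q unfolding judgement_model_def by blast+
      have "disjoint_family_on (judged I q) {1..label_count I}"
        using assms(2) q unfolding judgement_model_def by blast
      then have ne: "i1 \<noteq> i2"
        using j i unfolding disjoint_family_on_def by blast
      have "(\<Sum>i\<in>vertices I q. row_matrix \<rho> i * pagerank I q \<phi> i)
          = (\<Sum>i\<in>vertices I q. (if i = i1 then pagerank I q \<phi> i else 0)
                                 - (if i = i2 then pagerank I q \<phi> i else 0))"
        using ne by (intro sum.cong) (auto simp: \<rho> row_matrix_def)
      also have "\<dots> = pagerank I q \<phi> i1 - pagerank I q \<phi> i2"
        using fin V by (simp add: sum_subtractf)
      finally have "max ((\<Sum>i\<in>vertices I q. row_matrix \<rho> i * pagerank I q \<phi> i) + row_offset I \<rho>) 0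
          = - min (pagerank I q \<phi> i2 - pagerank I q \<phi> i1 + margin I j1 j2) 0"
        by (simp add: \<rho> row_offset_def max_def min_def)
      then show ?thesis
        by (simp add: \<rho> hinge_def)
    qed
    have "0 \<le> (\<Sum>\<rho>\<in>loss_rows I q. (max ((\<Sum>i\<in>vertices I q. row_matrix \<rho> i * pagerank I q \<phi> i)
                                      + row_offset I \<rho>) 0)\<^sup>2)"
      by (intro sum_nonneg) simp
    then show ?thesis
      unfolding L2_set_def by (simp add: entry cong: sum.cong)
  qed
  then show ?thesis
    by (simp add: objective_def loss_def)
qed

definition approx_pagerank ::
  "('q, 'v, 'a, 'b) pagerank_problem \<Rightarrow> nat \<Rightarrow> 'q \<Rightarrow> 'a \<times> 'b \<Rightarrow> 'v \<Rightarrow> real" where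
  "approx_pagerank I N q \<phi> i =
     damping I / (1 - (1 - damping I) ^ (N + 1)) *
     (\<Sum>n\<le>N. (1 - damping I) ^ n * (transition_transpose I q \<phi> ^^ n) (restart I q \<phi>) i)"

definition approx_objective ::
  "('q, 'v, 'a, 'b) pagerank_problem \<Rightarrow> nat \<Rightarrow> 'a \<times> 'b \<Rightarrow> real" where
  "approx_objective I N \<phi> = loss I (\<lambda>q. approx_pagerank I N q \<phi>)"


definition max_rows :: "('q, 'v, 'a, 'b) pagerank_problem \<Rightarrow> nat" where
  "max_rows I = Max ((\<lambda>q. card (loss_rows I q)) ` queries I)"

definition max_offset_norm :: "('q, 'v, 'a, 'b) pagerank_problem \<Rightarrow> real" where
  "max_offset_norm I = Max ((\<lambda>q. L2_set (row_offset I) (loss_rows I q)) ` queries I)"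

definition max_vertices :: "('q, 'v, 'a, 'b) pagerank_problem \<Rightarrow> nat" where
  "max_vertices I = Max ((\<lambda>q. card (vertices I q)) ` queries I)"

definition column_nonzeros ::
  "('q, 'v, 'a, 'b) pagerank_problem \<Rightarrow> 'q \<Rightarrow> 'a \<times> 'b \<Rightarrow> nat" where
  "column_nonzeros I q \<phi> =
     Max ((\<lambda>i. card {i' \<in> vertices I q. transition I q \<phi> i' i \<noteq> 0}) ` vertices I q)"

text \<open>The sparsity constant has to serve all parameters, so the maximum is also taken over them;
  it is a maximum over finitely many values, since \<open>column_nonzeros I q \<phi>\<close> is at most
  \<open>card (vertices I q)\<close>.\<close>

definition max_sparsity :: "('q, 'v, 'a, 'b) pagerank_problem \<Rightarrow> nat" where
  "max_sparsity I = Max ((\<lambda>q. Max (range (column_nonzeros I q))) ` queries I)"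


text \<open>The parameters \<open>L\<close>, \<open>R\<close>, \<open>\<epsilon>\<close> are the Lipschitz constant of the gradient, the radius and
  the accuracy; \<open>m\<close> is the dimension.\<close>

definition outer_count :: "nat \<Rightarrow> real \<Rightarrow> real \<Rightarrow> real \<Rightarrow> real" where
  "outer_count m L R \<epsilon> = 32 * real m * (L * R\<^sup>2 / \<epsilon>)"

definition noise_level :: "nat \<Rightarrow> real \<Rightarrow> real \<Rightarrow> real \<Rightarrow> real" where
  "noise_level m L R \<epsilon> = \<epsilon> powr (3/2) * sqrt 2 / (32 * real m * R * sqrt (L * (real m + 8)))"

definition smoothing :: "nat \<Rightarrow> real \<Rightarrow> real \<Rightarrow> real" where
  "smoothing m L \<epsilon> = sqrt (2 * \<epsilon> / (L * (real m + 8)))"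

definition inner_count ::
  "('q, 'v, 'a, 'b) pagerank_problem \<Rightarrow> nat \<Rightarrow> real \<Rightarrow> real \<Rightarrow> real \<Rightarrow> real" where
  "inner_count I m L R \<epsilon> =
     1 / damping I *
     ln (2 * sqrt (2 * real (max_rows I)) *
           (2 * sqrt (2 * real (max_rows I)) + 2 * max_offset_norm I)
           / noise_level m L R \<epsilon>)"

definition outer_iterations :: "nat \<Rightarrow> real \<Rightarrow> real \<Rightarrow> real \<Rightarrow> nat" where
  "outer_iterations m L R \<epsilon> = nat \<lceil>outer_count m L R \<epsilon>\<rceil>"

definition inner_iterations ::
  "('q, 'v, 'a, 'b) pagerank_problem \<Rightarrow> nat \<Rightarrow> real \<Rightarrow> real \<Rightarrow> real \<Rightarrow> nat" where
  "inner_iterations I m L R \<epsilon> = nat \<lceil>inner_count I m L R \<epsilon>\<rceil>"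

definition gradient_estimate ::
  "('x :: euclidean_space \<Rightarrow> real) \<Rightarrow> real \<Rightarrow> 'x \<Rightarrow> 'x \<Rightarrow> 'x" where
  "gradient_estimate g \<mu> x u = (real DIM('x) / \<mu> * (g (x + \<mu> *\<^sub>R u) - g x)) *\<^sub>R u"

definition method_step ::
  "('q, 'v, 'a :: euclidean_space, 'b :: euclidean_space) pagerank_problem \<Rightarrow>
     real \<Rightarrow> real \<Rightarrow> real \<Rightarrow> 'a \<times> 'b \<Rightarrow> 'a \<times> 'b \<Rightarrow> 'a \<times> 'b \<Rightarrow> 'a \<times> 'b" where
  "method_step I L R \<epsilon> \<phi>0 u \<phi> =
     closest_point (cball \<phi>0 (2 * R))
       (\<phi> - (1 / (8 * real DIM('a \<times> 'b) * L)) *\<^sub>R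
            gradient_estimate
              (approx_objective I (inner_iterations I DIM('a \<times> 'b) L R \<epsilon>))
              (smoothing DIM('a \<times> 'b) L \<epsilon>) \<phi> u)"

text \<open>\<open>u 0, u 1, \<dots>\<close> are the directions drawn; the \<open>k\<close>-th iterate depends on the first \<open>k\<close>
  of them only.\<close>

primrec iterate ::
  "('q, 'v, 'a :: euclidean_space, 'b :: euclidean_space) pagerank_problem \<Rightarrow>
     real \<Rightarrow> real \<Rightarrow> real \<Rightarrow> 'a \<times> 'b \<Rightarrow> (nat \<Rightarrow> 'a \<times> 'b) \<Rightarrow> nat \<Rightarrow> 'a \<times> 'b" where
  "iterate I L R \<epsilon> \<phi>0 u 0 = \<phi>0"
| "iterate I L R \<epsilon> \<phi>0 u (Suc k) = method_step I L R \<epsilon> \<phi>0 (u k) (iterate I L R \<epsilon> \<phi>0 u k)"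

definition output_point ::
  "('q, 'v, 'a :: euclidean_space, 'b :: euclidean_space) pagerank_problem \<Rightarrow>
     real \<Rightarrow> real \<Rightarrow> real \<Rightarrow> 'a \<times> 'b \<Rightarrow> (nat \<Rightarrow> 'a \<times> 'b) \<Rightarrow> 'a \<times> 'b" where
  "output_point I L R \<epsilon> \<phi>0 u =
     arg_min_on (objective I)
       (iterate I L R \<epsilon> \<phi>0 u ` {..outer_iterations DIM('a \<times> 'b) L R \<epsilon>})"

text \<open>Normalised surface measure, obtained by projecting the uniform distribution of the unit ball
  radially onto the unit sphere; the image of the origin is irrelevant.\<close>

definition uniform_sphere :: "'x :: euclidean_space measure" where
  "uniform_sphere = distr (uniform_measure lborel (cball 0 1)) borel (\<lambda>x. x /\<^sub>R norm x)"

definition history :: "nat \<Rightarrow> (nat \<Rightarrow> 'x :: euclidean_space) measure" where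
  "history M = (\<Pi>\<^sub>M k\<in>{..<M}. uniform_sphere)"


text \<open>Only the matrix-vector products in the computation of the approximate PageRank vectors are
  counted, at the two points visited in each iteration. The iterations that produce the iterates up to
  \<open>M\<close> are those numbered \<open>0, \<dots>, M - 1\<close>.\<close>

definition product_ops :: "('q, 'v, 'a, 'b) pagerank_problem \<Rightarrow> 'q \<Rightarrow> 'a \<times> 'b \<Rightarrow> nat" where
  "product_ops I q \<phi> = column_nonzeros I q \<phi> * card (vertices I q)"

definition run_ops ::
  "('q, 'v, 'a :: euclidean_space, 'b :: euclidean_space) pagerank_problem \<Rightarrow>
     real \<Rightarrow> real \<Rightarrow> real \<Rightarrow> 'a \<times> 'b \<Rightarrow> (nat \<Rightarrow> 'a \<times> 'b) \<Rightarrow> nat" where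
  "run_ops I L R \<epsilon> \<phi>0 u =
     (\<Sum>k<outer_iterations DIM('a \<times> 'b) L R \<epsilon>.
        let x = iterate I L R \<epsilon> \<phi>0 u k; y = x + smoothing DIM('a \<times> 'b) L \<epsilon> *\<^sub>R u k;
            N = inner_iterations I DIM('a \<times> 'b) L R \<epsilon>
        in \<Sum>q\<in>queries I. N * product_ops I q x + N * product_ops I q y)"

text \<open>The charge for \<open>M\<close> iterations with \<open>N\<close> matrix-vector products per vector, each product being
  charged the uniform amount \<open>s * p\<close>. \<open>M\<close> and \<open>N\<close> are real, so that the charge can be evaluated at
  the values before rounding.\<close>

definition charged_ops :: "('q, 'v, 'a, 'b) pagerank_problem \<Rightarrow> real \<Rightarrow> real \<Rightarrow> real" where
  "charged_ops I M N =
     M * (2 * real (card (queries I)) * (N * (real (max_sparsity I) * real (max_vertices I))))"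

end

theory Submission
  imports Defs
begin

text \<open>By the divergence theorem on the ball, the exact two-point estimator
  \<open>m / \<mu> * (f (x + \<mu> *\<^sub>R s) - f x) *\<^sub>R s\<close> has, for \<open>s\<close> uniform on the sphere, the gradient at \<open>x\<close>
  of the average of \<open>f\<close> over a ball of radius \<open>\<mu>\<close> as its mean. Convexity near the minimum therefore
  bounds its mean inner product with \<open>x - xs\<close> from below by \<open>f x - f xs - L / 2 * \<mu>\<^sup>2\<close>, and its second
  moment is controlled by \<open>(norm (grad x))\<^sup>2 \<le> 2 * L * (f x - f xs)\<close>. So the expected squared distance
  to \<open>xs\<close> decreases in each step by \<open>3 / 2 * \<gamma> * (f x - f xs)\<close>, \<open>\<gamma> = 1 / (8 * m * L)\<close>, up to
  \<open>3 / 4 * \<gamma> * \<epsilon>\<close>, and summing over the iterations gives the accuracy. The inexactness \<open>\<delta>\<close> of the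
  objective comes from truncating the Neumann series of the PageRank vector.\<close>

section \<open>The divergence theorem on the ball\<close>

text \<open>No surface measure is at hand: \<open>uniform_sphere\<close> is the radial image of the
  uniform law on the ball. The divergence theorem is therefore proved with volume integrals alone.
  The indicator of the ball is replaced by a Lipschitz cutoff, the derivative is moved onto the
  cutoff, and the thin shell where the cutoff decays plays the part of the boundary. The other
  obstacle is that \<open>f\<close> is known to be convex, and to stay above \<open>f xs\<close>,
  only in a ball around \<open>xs\<close>. Every use of convexity has to keep its points in that
  ball; hence the margin \<mu> around the feasible set and the shortened steps in
  \<open>grad_bound\<close>. The error budget closes only for \<epsilon> \<le> L R^2. For larger
  \<epsilon> the starting point itself is accurate enough, and it is among the candidates for the
  output.\<close>

lemma cball_in_borel [measurable]: "cball (x :: 'x::euclidean_space) r \<in> sets borel"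
  by simp

text \<open>Dominated convergence works along sequences, so the directional derivative is recorded
  for the step lengths 1/(n+1).\<close>

lemma gderiv_sequentially:
  fixes f :: "'x::euclidean_space \<Rightarrow> real"
  assumes "GDERIV f x :> g"
  shows "(\<lambda>n. (f (x + (1 / real (Suc n)) *\<^sub>R y) - f x) / (1 / real (Suc n))) \<longlonglongrightarrow> g \<bullet> y"
proof -
  have "((\<lambda>t::real. x + t *\<^sub>R y) has_derivative (\<lambda>t. t *\<^sub>R y)) (at 0)"
    by (auto intro!: derivative_eq_intros)
  moreover have "(f has_derivative (\<lambda>h. h \<bullet> g)) (at (x + 0 *\<^sub>R y))"
    using assms by (simp add: gderiv_def)
  ultimately have "((\<lambda>t. f (x + t *\<^sub>R y)) has_derivative (\<lambda>t. (t *\<^sub>R y) \<bullet> g)) (at 0)"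
    by (rule has_derivative_compose)
  moreover have "(\<lambda>t. (t *\<^sub>R y) \<bullet> g) = (*) (g \<bullet> y)"
    by (auto simp: inner_commute)
  ultimately have "((\<lambda>t. f (x + t *\<^sub>R y)) has_field_derivative (g \<bullet> y)) (at 0)"
    by (simp add: has_field_derivative_def)
  then have lim: "((\<lambda>t. (f (x + t *\<^sub>R y) - f x) / t) \<longlongrightarrow> g \<bullet> y) (at 0)"
    by (simp add: DERIV_def)
  have "filterlim (\<lambda>n. 1 / real (Suc n)) (at 0) sequentially"
    unfolding filterlim_at using LIMSEQ_Suc[OF lim_1_over_n]
    by (auto)
  from filterlim_compose[OF lim this] show ?thesis .
qed

lemma GDERIV_lipschitz_bound:
  fixes f :: "'x::euclidean_space \<Rightarrow> real"
  assumes "\<And>x. GDERIV f x :> g x" "convex S" "\<And>x. x \<in> S \<Longrightarrow> norm (g x) \<le> K" "a \<in> S" "b \<in> S"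
  shows "\<bar>f a - f b\<bar> \<le> K * norm (a - b)"
proof -
  have "norm (f a - f b) \<le> K * norm (a - b)"
  proof (rule differentiable_bound[OF assms(2)])
    show "(f has_derivative (\<lambda>h. h \<bullet> g x)) (at x within S)" if "x \<in> S" for x
      using assms(1)[of x] by (auto simp: gderiv_def intro: has_derivative_at_withinI)
    show "onorm (\<lambda>h. h \<bullet> g x) \<le> K" if "x \<in> S" for x
    proof (rule onorm_bound)
      show "0 \<le> K" using assms(3)[OF that] norm_ge_zero order_trans by blast
      fix h show "norm (h \<bullet> g x) \<le> K * norm h"
        using Cauchy_Schwarz_ineq2[of h "g x"] mult_right_mono[OF assms(3)[OF that], of "norm h"]
        by (simp add: mult.commute)
    qed
  qed (use assms in auto)
  then show ?thesis by simp
qed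

lemma GDERIV_continuous:
  fixes f :: "'x::euclidean_space \<Rightarrow> real"
  assumes "\<And>x. GDERIV f x :> g x"
  shows "continuous_on S f"
  using assms by (auto intro!: has_derivative_continuous_on simp: gderiv_def intro: has_derivative_at_withinI)

section \<open>Translation and scaling of Lebesgue integrals\<close>

lemma lborel_integral_translate:
  fixes f :: "'x::euclidean_space \<Rightarrow> real"
  assumes [measurable]: "f \<in> borel_measurable borel"
  shows "(\<integral>b. f (c + b) \<partial>lborel) = (\<integral>b. f b \<partial>lborel)"
proof -
  have "(\<integral>b. f b \<partial>lborel) = (\<integral>b. f b \<partial>distr lborel borel ((+) c))"
    by (simp add: lborel_distr_plus)
  also have "\<dots> = (\<integral>b. f (c + b) \<partial>lborel)"
    by (rule integral_distr) auto
  finally show ?thesis by simp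
qed

lemma lborel_integral_scale:
  fixes f :: "'x::euclidean_space \<Rightarrow> real"
  assumes [measurable]: "f \<in> borel_measurable borel" and c: "c \<noteq> 0"
  shows "(\<integral>b. f b \<partial>lborel) = \<bar>c\<bar> ^ DIM('x) * (\<integral>b. f (c *\<^sub>R b) \<partial>lborel)"
proof -
  have "(\<integral>b. f b \<partial>lborel)
      = (\<integral>b. f b \<partial>density (distr lborel borel (\<lambda>x. 0 + c *\<^sub>R x)) (\<lambda>_. ennreal (\<bar>c\<bar> ^ DIM('x))))"
    using lborel_affine[of c "0::'x"] c by (simp add: ennreal_power)
  also have "\<dots> = (\<integral>b. \<bar>c\<bar> ^ DIM('x) * f b \<partial>distr lborel borel (\<lambda>x. c *\<^sub>R x))"
    using c by (subst integral_density) auto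
  also have "\<dots> = (\<integral>b. \<bar>c\<bar> ^ DIM('x) * f (c *\<^sub>R b) \<partial>lborel)"
    by (rule integral_distr) auto
  finally show ?thesis by simp
qed

text \<open>The shell is a ball of radius 1 + h minus the unit ball, and the integral of a function
  constant along rays scales like the volume. This takes the place of polar coordinates.\<close>

lemma integral_shell_scale:
  fixes H :: "'x::euclidean_space \<Rightarrow> real"
  assumes [measurable]: "H \<in> borel_measurable borel" and h: "0 < h"
    and hom: "\<And>c b. 0 < c \<Longrightarrow> H (c *\<^sub>R b) = H b" and bd: "\<And>b. \<bar>H b\<bar> \<le> K"
  shows "(\<integral>b. indicator {b. 1 < norm b \<and> norm b \<le> 1 + h} b * H b \<partial>lborel)
       = ((1 + h) ^ DIM('x) - 1) * (\<integral>b. indicator (cball 0 1) b * H b \<partial>lborel)"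
proof -
  have int: "integrable lborel (\<lambda>b. indicator (cball 0 c) b * H b)" for c
  proof (rule Bochner_Integration.integrable_bound[where f = "\<lambda>b. indicator (cball 0 c) b *\<^sub>R K"])
    show "integrable lborel (\<lambda>b. indicator (cball (0::'x) c) b *\<^sub>R K)"
      by (rule borel_integrable_compact) auto
    have "0 \<le> K" using bd[of 0] by linarith
    then show "AE b in lborel. norm (indicator (cball 0 c) b * H b) \<le> norm (indicator (cball 0 c) b *\<^sub>R K)"
      using bd by (auto intro!: AE_I2 simp: indicator_def)
  qed measurable
  have "(\<integral>b. indicator {b. 1 < norm b \<and> norm b \<le> 1 + h} b * H b \<partial>lborel)
      = (\<integral>b. indicator (cball 0 (1 + h)) b * H b - indicator (cball 0 1) b * H b \<partial>lborel)"
    using h by (intro Bochner_Integration.integral_cong) (auto simp: indicator_def)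
  also have "\<dots> = (\<integral>b. indicator (cball 0 (1 + h)) b * H b \<partial>lborel)
                - (\<integral>b. indicator (cball 0 1) b * H b \<partial>lborel)"
    by (rule Bochner_Integration.integral_diff[OF int int])
  also have "(\<integral>b. indicator (cball 0 (1 + h)) b * H b \<partial>lborel)
      = \<bar>1 + h\<bar> ^ DIM('x) * (\<integral>b. indicator (cball 0 (1 + h)) ((1 + h) *\<^sub>R b) * H ((1 + h) *\<^sub>R b) \<partial>lborel)"
    using h by (intro lborel_integral_scale borel_measurable_times borel_measurable_indicator) (use assms(1) in auto)
  also have "(\<integral>b. indicator (cball 0 (1 + h)) ((1 + h) *\<^sub>R b) * H ((1 + h) *\<^sub>R b) \<partial>lborel)
      = (\<integral>b. indicator (cball 0 1) b * H b \<partial>lborel)"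
    using h by (intro Bochner_Integration.integral_cong) (auto simp: indicator_def hom)
  finally show ?thesis using h by (simp add: algebra_simps)
qed

text \<open>A Lipschitz substitute for the indicator of the unit ball, falling linearly in the norm
  across a shell of width h. Its gradient there is -1/h times the outward unit normal, so
  integrating against it averages over the shell; as h tends to 0 this becomes a surface
  average.\<close>

definition cutoff :: "real \<Rightarrow> 'x::real_normed_vector \<Rightarrow> real" where
  "cutoff h b = max 0 (min 1 ((1 + h - norm b) / h))"

lemma cutoff_lipschitz:
  assumes "0 < h" shows "\<bar>cutoff h a - cutoff h b\<bar> \<le> norm (a - b) / h"
proof -
  have "\<bar>cutoff h a - cutoff h b\<bar> \<le> \<bar>(1 + h - norm a) / h - (1 + h - norm b) / h\<bar>"
    unfolding cutoff_def by (simp add: max_def min_def)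
  also have "\<dots> = \<bar>norm b - norm a\<bar> / h"
    using assms by (simp add: diff_divide_distrib[symmetric] abs_div)
  also have "\<dots> \<le> norm (a - b) / h"
    using assms norm_triangle_ineq3[of b a] by (intro divide_right_mono) (auto simp: norm_minus_commute)
  finally show ?thesis .
qed

lemma cutoff_eq:
  assumes "0 < h"
  shows "norm b \<le> 1 \<Longrightarrow> cutoff h b = 1" "1 + h \<le> norm b \<Longrightarrow> cutoff h b = 0"
    "1 \<le> norm b \<Longrightarrow> norm b \<le> 1 + h \<Longrightarrow> cutoff h b = (1 + h - norm b) / h"
  and cutoff_bounds: "0 \<le> cutoff h b" "cutoff h b \<le> 1"
  using assms by (auto simp: cutoff_def max_def min_def divide_simps)

lemma continuous_cutoff: "0 < h \<Longrightarrow> continuous_on S (cutoff h)"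
  unfolding cutoff_def by (intro continuous_intros) auto

text \<open>The excluded spheres are the kinks of the radial profile. They are null sets, so the
  formula is available almost everywhere. The origin, where the norm has its own kink, is harmless
  because the cutoff is constant near it.\<close>

lemma cutoff_gderiv:
  fixes b :: "'x::euclidean_space"
  assumes h: "0 < h" and b: "norm b \<noteq> 1" "norm b \<noteq> 1 + h"
  shows "GDERIV (cutoff h) b :> - (indicator {b. 1 < norm b \<and> norm b \<le> 1 + h} b / h) *\<^sub>R (b /\<^sub>R norm b)"
proof -
  consider "norm b < 1" | "1 + h < norm b" | "1 < norm b" "norm b < 1 + h" using b by linarith
  then show ?thesis
  proof cases
    case 1
    have "((\<lambda>_. 1::real) has_derivative (\<lambda>_. 0)) (at b)" by simp
    then have "(cutoff h has_derivative (\<lambda>_. 0)) (at b)"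
      by (rule has_derivative_transform_within_open[where s = "ball 0 1"])
         (use 1 h in \<open>auto simp: cutoff_eq\<close>)
    then show ?thesis using 1 by (simp add: gderiv_def)
  next
    case 2
    have "((\<lambda>_. 0::real) has_derivative (\<lambda>_. 0)) (at b)" by simp
    then have "(cutoff h has_derivative (\<lambda>_. 0)) (at b)"
      by (rule has_derivative_transform_within_open[where s = "- cball 0 (1 + h)"])
         (use 2 h in \<open>auto simp: cutoff_eq open_Compl\<close>)
    then show ?thesis using 2 by (simp add: gderiv_def)
  next
    case 3
    then have "b \<noteq> 0" by auto
    then have "((\<lambda>b. (1 + h - norm b) / h) has_derivative (\<lambda>v. - (v \<bullet> sgn b) / h)) (at b)"
      using h by (auto intro!: derivative_eq_intros has_derivative_norm)
    then have "(cutoff h has_derivative (\<lambda>v. - (v \<bullet> sgn b) / h)) (at b)"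
      by (rule has_derivative_transform_within_open[where s = "ball 0 (1 + h) - cball 0 1"])
         (use 3 h in \<open>auto simp: cutoff_eq open_Diff\<close>)
    then show ?thesis using 3 by (simp add: gderiv_def sgn_div_norm)
  qed
qed

lemma continuous_support_integrable:
  fixes f :: "'x::euclidean_space \<Rightarrow> real"
  assumes "continuous_on UNIV f" "\<And>b. norm b > c \<Longrightarrow> f b = 0"
  shows "integrable lborel f"
proof -
  have "integrable lborel (\<lambda>b. indicator (cball 0 c) b *\<^sub>R f b)"
    by (rule borel_integrable_compact) (auto intro: continuous_on_subset assms)
  moreover have "(\<lambda>b. indicator (cball 0 c) b *\<^sub>R f b) = f"
    using assms(2) by (auto simp: indicator_def fun_eq_iff not_le)
  ultimately show ?thesis by simp
qed

lemma AE_norm_ne: "0 < r \<Longrightarrow> AE b in lborel. norm (b::'x::euclidean_space) \<noteq> r"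
proof -
  have "negligible (sphere (0::'x) r)" by (rule negligible_sphere)
  then have "sphere (0::'x) r \<in> null_sets lborel"
    by (simp add: negligible_iff_null_sets null_sets_completion_iff)
  then have "AE b in lborel. b \<notin> sphere (0::'x) r" by (rule AE_not_in)
  then show ?thesis by simp
qed

text \<open>Translation invariance of the Lebesgue measure: the integral of the difference quotient of
  \<open>cutoff h b * F b\<close> in the direction \<open>y\<close> vanishes.\<close>

lemma cutoff_integration_by_parts:
  fixes F :: "'x::euclidean_space \<Rightarrow> real"
  assumes F: "\<And>x. GDERIV F x :> G x" and contG: "continuous_on UNIV G" and h: "0 < h" "h \<le> 1"
  shows "(\<integral>b. cutoff h b * (G b \<bullet> y) \<partial>lborel)
       = (\<integral>b. indicator {b. 1 < norm b \<and> norm b \<le> 1 + h} b * (F b * ((b /\<^sub>R norm b) \<bullet> y)) \<partial>lborel) / h"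
proof -
  define t where "t = (\<lambda>n. 1 / real (Suc n))"
  have t: "0 < t n" "t n \<le> 1" for n by (auto simp: t_def)
  \<comment> \<open>The cutoff lives in norm at most 1 + h \<le> 2, and the translations have length
    at most \<open>norm y\<close>. So S contains the supports of all the functions
    \<open>A n\<close> and \<open>B n\<close>.\<close>
  define S where "S = cball (0::'x) (2 + norm y)"
  have contF: "continuous_on T F" for T by (rule GDERIV_continuous[OF F])
  note [continuous_intros] = continuous_on_compose2[OF contF[of UNIV]] continuous_on_compose2[OF contG]
    continuous_on_compose2[OF continuous_cutoff[OF h(1), of UNIV]]
  have [measurable]: "F \<in> borel_measurable borel" "G \<in> borel_measurable borel"
    "(cutoff h :: 'x \<Rightarrow> real) \<in> borel_measurable borel"
    using contF contG continuous_cutoff[OF h(1)] by (auto intro: borel_measurable_continuous_onI)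
  have "compact S" by (simp add: S_def)
  then have "bounded (F ` S)" "bounded (G ` S)"
    using contF contG by (auto intro!: compact_imp_bounded compact_continuous_image intro: continuous_on_subset)
  then obtain K1 K2 where K1: "\<And>b. b \<in> S \<Longrightarrow> \<bar>F b\<bar> \<le> K1" and K2: "\<And>b. b \<in> S \<Longrightarrow> norm (G b) \<le> K2"
    by (auto simp: bounded_iff)
  have S0: "0 \<in> S" by (simp add: S_def)
  have K0: "0 \<le> K1" "0 \<le> K2" using K1[OF S0] K2[OF S0] norm_ge_zero[of "G 0"] by linarith+
  have ty: "norm (t n *\<^sub>R y) \<le> norm y" for n
    using t[of n] by (simp add: mult_left_le_one_le)
  \<comment> \<open>\<open>A n\<close> carries the difference quotient on F, \<open>B n\<close> on
    the cutoff. Translating the variable by \<open>- t n *\<^sub>R y\<close> makes their integrals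
    equal; hence the reversed direction \<open>- y\<close> in \<open>B n\<close>.\<close>
  define A where "A = (\<lambda>n b. cutoff h b * ((F (b + t n *\<^sub>R y) - F b) / t n))"
  define B where "B = (\<lambda>n b. F b * ((cutoff h (b + t n *\<^sub>R (- y)) - cutoff h b) / t n))"
  have AB: "integral\<^sup>L lborel (A n) = integral\<^sup>L lborel (B n)" for n
  proof -
    let ?z = "t n *\<^sub>R y"
    have zero: "cutoff h b = 0" if "norm b > 2 + norm y" for b :: 'x
      using that h norm_ge_zero[of y] by (intro cutoff_eq) linarith+
    have zero': "cutoff h (b + t n *\<^sub>R (- y)) = 0" if "norm b > 2 + norm y" for b :: 'x
    proof (rule cutoff_eq[OF h(1)])
      have "norm b - norm ?z \<le> norm (b + t n *\<^sub>R (- y))" using norm_triangle_ineq2[of b ?z] by simp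
      then show "1 + h \<le> norm (b + t n *\<^sub>R (- y))" using that h ty[of n] by linarith
    qed
    have i1: "integrable lborel (\<lambda>b. cutoff h b * F (b + ?z) / t n)"
      using t[of n] by (intro continuous_support_integrable[where c = "2 + norm y"] continuous_intros) (auto simp: zero)
    have i2: "integrable lborel (\<lambda>b. cutoff h b * F b / t n)"
      using t[of n] by (intro continuous_support_integrable[where c = "2 + norm y"] continuous_intros) (auto simp: zero)
    have i3: "integrable lborel (\<lambda>b. cutoff h (b + t n *\<^sub>R (- y)) * F b / t n)"
      using t[of n] by (intro continuous_support_integrable[where c = "2 + norm y"] continuous_intros) (use zero' in auto)
    have "integral\<^sup>L lborel (A n)
        = (\<integral>b. cutoff h b * F (b + ?z) / t n \<partial>lborel) - (\<integral>b. cutoff h b * F b / t n \<partial>lborel)"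
      unfolding A_def by (subst Bochner_Integration.integral_diff[OF i1 i2, symmetric])
        (simp add: diff_divide_distrib right_diff_distrib)
    also have "(\<integral>b. cutoff h b * F (b + ?z) / t n \<partial>lborel)
        = (\<integral>b. cutoff h ((- ?z) + b) * F ((- ?z) + b + ?z) / t n \<partial>lborel)"
      by (rule lborel_integral_translate[symmetric]) measurable
    also have "\<dots> = (\<integral>b. cutoff h (b + t n *\<^sub>R (- y)) * F b / t n \<partial>lborel)"
      by (simp add: algebra_simps)
    also have "\<dots> - (\<integral>b. cutoff h b * F b / t n \<partial>lborel) = integral\<^sup>L lborel (B n)"
      unfolding B_def by (subst Bochner_Integration.integral_diff[OF i3 i2, symmetric])
        (simp add: diff_divide_distrib left_diff_distrib right_diff_distrib mult.commute)
    finally show ?thesis .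
  qed
  have "(\<lambda>n. integral\<^sup>L lborel (A n)) \<longlonglongrightarrow> (\<integral>b. cutoff h b * (G b \<bullet> y) \<partial>lborel)"
  proof (rule integral_dominated_convergence[where w = "\<lambda>b. indicator S b *\<^sub>R (K2 * norm y)"])
    show "AE b in lborel. (\<lambda>n. A n b) \<longlonglongrightarrow> cutoff h b * (G b \<bullet> y)"
      unfolding A_def t_def by (intro AE_I2 tendsto_intros gderiv_sequentially F)
    show "AE b in lborel. norm (A n b) \<le> indicator S b *\<^sub>R (K2 * norm y)" for n
    proof (rule AE_I2)
      fix b :: 'x
      show "norm (A n b) \<le> indicator S b *\<^sub>R (K2 * norm y)"
      proof (cases "norm b \<le> 2")
        case True
        have m: "b \<in> S" "b + t n *\<^sub>R y \<in> S"
          using True ty[of n] norm_triangle_ineq[of b "t n *\<^sub>R y"] norm_ge_zero[of y] unfolding S_def mem_cball_0 by linarith+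
        have "\<bar>F (b + t n *\<^sub>R y) - F b\<bar> \<le> K2 * norm (b + t n *\<^sub>R y - b)"
          by (rule GDERIV_lipschitz_bound[OF F _ _ m(2,1)]) (auto simp: S_def intro: K2[unfolded S_def])
        then have "\<bar>F (b + t n *\<^sub>R y) - F b\<bar> / t n \<le> K2 * norm y"
          using t[of n] by (simp add: field_simps)
        then have "\<bar>cutoff h b\<bar> * (\<bar>F (b + t n *\<^sub>R y) - F b\<bar> / t n) \<le> 1 * (K2 * norm y)"
          using cutoff_bounds[OF h(1), of b] t[of n] by (intro mult_mono) auto
        then show ?thesis using m t[of n] by (simp add: A_def abs_mult abs_div)
      next
        case False
        then have "cutoff h b = 0" using h by (intro cutoff_eq) linarith+
        then show ?thesis using K0 by (simp add: A_def)
      qed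
    qed
    show "integrable lborel (\<lambda>b. indicator S b *\<^sub>R (K2 * norm y))"
      by (rule borel_integrable_compact) (use \<open>compact S\<close> in auto)
  qed (simp_all add: A_def)
  moreover have "(\<lambda>n. integral\<^sup>L lborel (B n)) \<longlonglongrightarrow>
      (\<integral>b. F b * (- (indicator {b. 1 < norm b \<and> norm b \<le> 1 + h} b / h) *\<^sub>R (b /\<^sub>R norm b) \<bullet> (- y)) \<partial>lborel)"
  proof (rule integral_dominated_convergence[where w = "\<lambda>b. indicator S b *\<^sub>R (K1 * (norm y / h))"])
    have "AE b in lborel. norm (b::'x) \<noteq> 1 \<and> norm b \<noteq> 1 + h"
      using AE_norm_ne[of 1] AE_norm_ne[of "1 + h"] h by auto
    then show "AE b in lborel. (\<lambda>n. B n b) \<longlonglongrightarrow>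
        F b * (- (indicator {b. 1 < norm b \<and> norm b \<le> 1 + h} b / h) *\<^sub>R (b /\<^sub>R norm b) \<bullet> (- y))"
      by eventually_elim (unfold B_def t_def, intro tendsto_intros gderiv_sequentially cutoff_gderiv h, auto)
    show "AE b in lborel. norm (B n b) \<le> indicator S b *\<^sub>R (K1 * (norm y / h))" for n
    proof (rule AE_I2)
      fix b :: 'x
      show "norm (B n b) \<le> indicator S b *\<^sub>R (K1 * (norm y / h))"
      proof (cases "b \<in> S")
        case True
        have "\<bar>cutoff h (b + t n *\<^sub>R (- y)) - cutoff h b\<bar> / t n \<le> norm (t n *\<^sub>R y) / h / t n"
          using cutoff_lipschitz[OF h(1), of "b + t n *\<^sub>R (- y)" b] t[of n] by (intro divide_right_mono) auto
        also have "\<dots> = norm y / h" using t[of n] by simp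
        finally have "\<bar>F b\<bar> * (\<bar>cutoff h (b + t n *\<^sub>R (- y)) - cutoff h b\<bar> / t n) \<le> K1 * (norm y / h)"
          using K1[OF True] t[of n] K0 by (intro mult_mono) auto
        then show ?thesis using True t[of n] by (simp add: B_def abs_mult abs_div)
      next
        case False
        then have b: "norm b > 2 + norm y" by (simp add: S_def)
        have "norm b - norm (t n *\<^sub>R y) \<le> norm (b + t n *\<^sub>R (- y))"
          using norm_triangle_ineq2[of b "t n *\<^sub>R y"] by simp
        then have "cutoff h (b + t n *\<^sub>R (- y)) = 0" "cutoff h b = 0"
          using b h ty[of n] norm_ge_zero[of y] by (intro cutoff_eq[OF h(1)]; linarith)+
        then show ?thesis using False by (simp add: B_def)
      qed
    qed
    show "integrable lborel (\<lambda>b. indicator S b *\<^sub>R (K1 * (norm y / h)))"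
      by (rule borel_integrable_compact) (use \<open>compact S\<close> in auto)
  qed (simp_all add: B_def)
  ultimately have "(\<integral>b. cutoff h b * (G b \<bullet> y) \<partial>lborel)
      = (\<integral>b. F b * (- (indicator {b. 1 < norm b \<and> norm b \<le> 1 + h} b / h) *\<^sub>R (b /\<^sub>R norm b) \<bullet> (- y)) \<partial>lborel)"
    unfolding AB by (rule LIMSEQ_unique)
  also have "\<dots> = (\<integral>b. (indicator {b. 1 < norm b \<and> norm b \<le> 1 + h} b * (F b * ((b /\<^sub>R norm b) \<bullet> y))) / h \<partial>lborel)"
    by (intro Bochner_Integration.integral_cong) auto
  finally show ?thesis by simp
qed

section \<open>Uniform distributions on the unit ball and sphere\<close>

lemma content_cball_1_pos: "0 < measure lborel (cball (0::'x::euclidean_space) 1)"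
  using content_cball_pos[of 1 "0::'x"] by simp

lemma uniform_ball_density:
  "uniform_measure lborel (cball (0::'x::euclidean_space) 1)
     = density lborel (\<lambda>b. ennreal (indicator (cball 0 1) b / measure lborel (cball (0::'x) 1)))"
proof -
  have "emeasure lborel (cball (0::'x) 1) = ennreal (measure lborel (cball (0::'x) 1))"
    using emeasure_lborel_cball_finite[of "0::'x" 1] by (intro emeasure_eq_ennreal_measure) (auto simp: less_top)
  then show ?thesis
    unfolding uniform_measure_def using content_cball_1_pos[where 'x = 'x]
    by (intro arg_cong2[where f = density] refl) (auto simp: fun_eq_iff indicator_def divide_ennreal ennreal_1[symmetric] simp del: ennreal_1)
qed

lemma integral_uniform_ball:
  fixes f :: "'x::euclidean_space \<Rightarrow> real"
  assumes "f \<in> borel_measurable borel"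
  shows "(\<integral>b. f b \<partial>uniform_measure lborel (cball 0 1))
       = (\<integral>b. indicator (cball 0 1) b * f b \<partial>lborel) / measure lborel (cball (0::'x) 1)"
proof -
  have "(\<integral>b. f b \<partial>uniform_measure lborel (cball 0 1))
      = (\<integral>b. (indicator (cball 0 1) b / measure lborel (cball (0::'x) 1)) *\<^sub>R f b \<partial>lborel)"
    unfolding uniform_ball_density using assms by (intro integral_density) (auto intro!: AE_I2 borel_measurable_divide borel_measurable_indicator)
  also have "\<dots> = (\<integral>b. (indicator (cball 0 1) b * f b) / measure lborel (cball (0::'x) 1) \<partial>lborel)"
    by (intro Bochner_Integration.integral_cong) auto
  finally show ?thesis by simp
qed

lemma prob_space_uniform_ball: "prob_space (uniform_measure lborel (cball (0::'x::euclidean_space) 1))"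
proof (rule prob_space_uniform_measure)
  show "emeasure lborel (cball (0::'x) 1) \<noteq> 0"
    using content_cball_1_pos[where 'x = 'x] by (auto simp: measure_def)
  show "emeasure lborel (cball (0::'x) 1) \<noteq> \<infinity>"
    using emeasure_lborel_cball_finite[of "0::'x" 1] by auto
qed

lemma norm_normalize_le: "norm (b /\<^sub>R norm b) \<le> 1" for b :: "'x::real_normed_vector"
  by (cases "b = 0") simp_all

lemma prob_space_uniform_sphere: "prob_space (uniform_sphere :: 'x::euclidean_space measure)"
proof -
  interpret prob_space "uniform_measure lborel (cball (0::'x) 1)" by (rule prob_space_uniform_ball)
  show ?thesis unfolding uniform_sphere_def by (rule prob_space_distr) auto
qed

lemma sets_uniform_sphere [measurable_cong, simp]: "sets uniform_sphere = sets borel"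
  and space_uniform_sphere [simp]: "space uniform_sphere = UNIV"
  by (simp_all add: uniform_sphere_def)

text \<open>An upper bound instead of norm 1 avoids treating the origin, which the radial projection
  sends to 0. The pointwise estimates on directions below are all made under this bound.\<close>

lemma AE_uniform_sphere: "AE s in uniform_sphere. norm (s :: 'x::euclidean_space) \<le> 1"
  unfolding uniform_sphere_def by (subst AE_distr_iff) (auto intro!: always_eventually simp del: norm_scaleR simp: norm_normalize_le)

text \<open>Both sides are compared with the integral of the cutoff times
  \<open>G b \<bullet> y\<close>. It differs from the integral over the ball only by a shell
  contribution. After integration by parts it is 1/h times a shell integral of F times the normal
  component, in which F may be evaluated at the radial projection. The ratio ((1 + h)^d - 1) / h
  tends to d, which is where the factor \<open>DIM('x)\<close> comes from.\<close>

lemma ball_divergence: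
  fixes F :: "'x::euclidean_space \<Rightarrow> real"
  assumes F: "\<And>x. GDERIV F x :> G x" and contG: "continuous_on UNIV G"
  shows "real DIM('x) * (\<integral>s. F s * (s \<bullet> y) \<partial>uniform_sphere)
       = (\<integral>b. G b \<bullet> y \<partial>uniform_measure lborel (cball 0 1))"
proof -
  define V where "V = measure lborel (cball (0::'x) 1)"
  have V: "0 < V" unfolding V_def by (rule content_cball_1_pos)
  \<comment> \<open>The sphere integrand extended constantly along rays; its mean over the ball is
    the sphere integral, by the construction of \<open>uniform_sphere\<close>.\<close>
  define H where "H = (\<lambda>b::'x. F (b /\<^sub>R norm b) * ((b /\<^sub>R norm b) \<bullet> y))"
  define X where "X = (\<integral>b. indicator (cball 0 1) b * (G b \<bullet> y) \<partial>lborel)"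
  define Y where "Y = (\<integral>b. indicator (cball 0 1) b * H b \<partial>lborel)"
  define shell where "shell = (\<lambda>h. {b::'x. 1 < norm b \<and> norm b \<le> 1 + h})"
  define t where "t = (\<lambda>n. 1 / real (Suc n))"
  define c where "c = (\<lambda>h::real. (1 + h) ^ DIM('x) - 1)"
  have contF: "continuous_on T F" for T by (rule GDERIV_continuous[OF F])
  have [measurable]: "F \<in> borel_measurable borel" "G \<in> borel_measurable borel"
    using contF contG by (auto intro: borel_measurable_continuous_onI)
  have [measurable]: "H \<in> borel_measurable borel" unfolding H_def by measurable
  have [measurable]: "shell h \<in> sets borel" for h unfolding shell_def by measurable
  have "bounded (F ` cball 0 2)" "bounded (G ` cball 0 2)"
    using contF contG by (auto intro!: compact_imp_bounded compact_continuous_image intro: continuous_on_subset)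
  then obtain K1 K2 where K12: "\<forall>r\<in>F ` cball 0 2. norm r \<le> K1" "\<forall>v\<in>G ` cball 0 2. norm v \<le> K2"
    unfolding bounded_iff by blast
  define K where "K = max K1 K2"
  have K: "\<bar>F b\<bar> \<le> K" "norm (G b) \<le> K" if "norm b \<le> 2" for b
    using K12 that by (auto simp: K_def le_max_iff_disj)
  have K0: "0 \<le> K" using K(1)[of 0] by simp
  have unit: "norm (b /\<^sub>R norm b) \<le> 1" for b :: 'x by (rule norm_normalize_le)
  have inner_bd: "\<bar>v \<bullet> y\<bar> \<le> C * norm y" if "norm v \<le> C" for v C
    using Cauchy_Schwarz_ineq2[of v y] mult_right_mono[OF that, of "norm y"] by simp
  have H_bd: "\<bar>H b\<bar> \<le> K * norm y" for b
  proof -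
    have "\<bar>H b\<bar> \<le> K * (1 * norm y)"
      unfolding H_def abs_mult using unit[of b] K0 by (intro mult_mono K inner_bd) auto
    then show ?thesis by simp
  qed
  have hom: "(c *\<^sub>R b) /\<^sub>R norm (c *\<^sub>R b) = b /\<^sub>R norm b" if "0 < c" for c and b :: 'x
    using that by (simp add: field_simps)
  have shell_H: "(\<integral>b. indicator (shell h) b * H b \<partial>lborel) = c h * Y" if "0 < h" for h
    unfolding shell_def c_def Y_def
    by (rule integral_shell_scale[where K = "K * norm y"]) (use that H_bd in \<open>auto simp only: H_def hom\<close>, measurable)
  have shell_1: "(\<integral>b. indicator (shell h) b * 1 \<partial>lborel) = c h * V" if "0 < h" for h
    unfolding shell_def c_def V_def
    by (subst integral_shell_scale[where K = 1]) (use that in \<open>auto simp: mult.commute\<close>)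
  have int: "integrable lborel (\<lambda>b. indicator A b * g b)"
    if [measurable]: "A \<in> sets borel" "g \<in> borel_measurable borel" and A: "A \<subseteq> cball 0 2" and g: "\<And>b. b \<in> A \<Longrightarrow> \<bar>g b\<bar> \<le> C" "0 \<le> C"
    for A and g :: "'x \<Rightarrow> real" and C
  proof (rule Bochner_Integration.integrable_bound[where f = "\<lambda>b. indicator (cball 0 2) b *\<^sub>R C"])
    show "integrable lborel (\<lambda>b. indicator (cball (0::'x) 2) b *\<^sub>R C)"
      by (rule borel_integrable_compact) auto
    show "AE b in lborel. norm (indicator A b * g b) \<le> norm (indicator (cball 0 2) b *\<^sub>R C)"
      using A g by (intro AE_I2) (auto simp: indicator_def)
  qed measurable
  \<comment> \<open>Two errors arise: the part of the cutoff integral on the shell, and moving F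
    from the shell to the sphere. Each is at most \<open>K * norm y\<close> times the shell volume
    \<open>c h * V\<close>; in the second, the displacement of at most h cancels the factor
    1/h.\<close>
  have main: "\<bar>X - c h / h * Y\<bar> \<le> 2 * (K * norm y * (c h * V))" if h: "0 < h" "h \<le> 1" for h
  proof -
    have sub: "shell h \<subseteq> cball 0 2" using h by (auto simp: shell_def)
    have Gy: "\<bar>G b \<bullet> y\<bar> \<le> K * norm y" if "norm b \<le> 2" for b
      using that by (intro inner_bd K)
    have [measurable]: "(cutoff h :: 'x \<Rightarrow> real) \<in> borel_measurable borel"
      using continuous_cutoff[OF h(1)] by (auto intro: borel_measurable_continuous_onI)
    define Z where "Z = (\<integral>b. cutoff h b * (G b \<bullet> y) \<partial>lborel)"
    have Z2: "Z = (\<integral>b. indicator (shell h) b * (F b * ((b /\<^sub>R norm b) \<bullet> y)) \<partial>lborel) / h"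
      unfolding Z_def shell_def by (rule cutoff_integration_by_parts[OF F contG h])
    have i1: "integrable lborel (\<lambda>b. indicator (cball 0 1) b * (G b \<bullet> y))"
      by (rule int[where C = "K * norm y"]) (use K0 Gy in auto)
    have i2: "integrable lborel (\<lambda>b. indicator (shell h) b * (cutoff h b * (G b \<bullet> y)))"
    proof (rule int[where C = "1 * (K * norm y)"])
      show "\<bar>cutoff h b * (G b \<bullet> y)\<bar> \<le> 1 * (K * norm y)" if "b \<in> shell h" for b
        unfolding abs_mult using sub that cutoff_bounds[OF h(1), of b] by (intro mult_mono Gy) auto
    qed (use K0 sub in auto)
    have i3: "integrable lborel (\<lambda>b. indicator (shell h) b * (K * norm y))"
      by (rule int[where C = "K * norm y"]) (use K0 sub in auto)
    have Zsplit: "Z = X + (\<integral>b. indicator (shell h) b * (cutoff h b * (G b \<bullet> y)) \<partial>lborel)"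
      unfolding Z_def X_def Bochner_Integration.integral_add[OF i1 i2, symmetric]
      using h by (intro Bochner_Integration.integral_cong) (auto simp: indicator_def shell_def cutoff_eq)
    have "\<bar>\<integral>b. indicator (shell h) b * (cutoff h b * (G b \<bullet> y)) \<partial>lborel\<bar>
        \<le> (\<integral>b. indicator (shell h) b * (K * norm y) \<partial>lborel)"
    proof (rule order_trans[OF integral_abs_bound integral_mono[OF integrable_abs[OF i2] i3]])
      fix b :: 'x
      show "\<bar>indicator (shell h) b * (cutoff h b * (G b \<bullet> y))\<bar> \<le> indicator (shell h) b * (K * norm y)"
      proof (cases "b \<in> shell h")
        case True
        have "\<bar>cutoff h b * (G b \<bullet> y)\<bar> \<le> 1 * (K * norm y)"
          unfolding abs_mult using sub True cutoff_bounds[OF h(1), of b] by (intro mult_mono Gy) auto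
        then show ?thesis using True by simp
      qed simp
    qed
    also have "\<dots> = (\<integral>b. (indicator (shell h) b * 1) * (K * norm y) \<partial>lborel)" by simp
    also have "\<dots> = K * norm y * (c h * V)"
      by (subst integral_mult_left_zero) (simp only: shell_1[OF h(1)], simp only: mult_ac)
    finally have XZ: "\<bar>X - Z\<bar> \<le> K * norm y * (c h * V)" using Zsplit by simp
    let ?D = "\<lambda>b. F b * ((b /\<^sub>R norm b) \<bullet> y) - H b"
    have D: "\<bar>?D b\<bar> \<le> h * (K * norm y)" if "b \<in> shell h" for b
    proof -
      have b: "1 < norm b" "norm b \<le> 1 + h" using that by (auto simp: shell_def)
      have "b \<noteq> 0" using b by auto
      have "b - b /\<^sub>R norm b = (1 - 1 / norm b) *\<^sub>R b" by (simp add: algebra_simps divide_inverse)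
      moreover have "0 \<le> 1 - 1 / norm b" using b by (simp add: divide_le_eq)
      ultimately have "norm (b - b /\<^sub>R norm b) = (1 - 1 / norm b) * norm b" by simp
      also have "\<dots> = norm b - 1" using \<open>b \<noteq> 0\<close> by (simp add: field_simps)
      finally have nb: "norm (b - b /\<^sub>R norm b) \<le> h" using b by simp
      have "\<bar>F b - F (b /\<^sub>R norm b)\<bar> \<le> K * norm (b - b /\<^sub>R norm b)"
        by (rule GDERIV_lipschitz_bound[where S = "cball 0 2", OF F]) (use K b h unit[of b] in auto)
      also have "\<dots> \<le> K * h" using nb K0 by (intro mult_left_mono)
      finally have "\<bar>F b - F (b /\<^sub>R norm b)\<bar> * \<bar>(b /\<^sub>R norm b) \<bullet> y\<bar> \<le> (K * h) * (1 * norm y)"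
        using K0 h unit[of b] by (intro mult_mono inner_bd) auto
      moreover have "\<bar>?D b\<bar> = \<bar>F b - F (b /\<^sub>R norm b)\<bar> * \<bar>(b /\<^sub>R norm b) \<bullet> y\<bar>"
        unfolding abs_mult[symmetric] by (simp only: H_def left_diff_distrib)
      ultimately show ?thesis by (simp only: mult_ac mult_1)
    qed
    have i4: "integrable lborel (\<lambda>b. indicator (shell h) b * ?D b)"
      by (rule int[where C = "h * (K * norm y)"]) (use K0 h sub D in auto)
    have i5: "integrable lborel (\<lambda>b. indicator (shell h) b * (h * (K * norm y)))"
      by (rule int[where C = "h * (K * norm y)"]) (use K0 h sub in auto)
    have i6: "integrable lborel (\<lambda>b. indicator (shell h) b * H b)"
      by (rule int[where C = "K * norm y"]) (use K0 H_bd sub in auto)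
    have "\<bar>\<integral>b. indicator (shell h) b * ?D b \<partial>lborel\<bar> \<le> (\<integral>b. indicator (shell h) b * (h * (K * norm y)) \<partial>lborel)"
    proof (rule order_trans[OF integral_abs_bound integral_mono[OF integrable_abs[OF i4] i5]])
      fix b :: 'x
      show "\<bar>indicator (shell h) b * ?D b\<bar> \<le> indicator (shell h) b * (h * (K * norm y))"
        using D[of b] by (cases "b \<in> shell h") auto
    qed
    also have "\<dots> = (\<integral>b. (indicator (shell h) b * 1) * (h * (K * norm y)) \<partial>lborel)" by simp
    also have "\<dots> = h * (K * norm y * (c h * V))"
      by (subst integral_mult_left_zero) (simp only: shell_1[OF h(1)], simp only: mult_ac)
    finally have e: "\<bar>\<integral>b. indicator (shell h) b * ?D b \<partial>lborel\<bar> \<le> h * (K * norm y * (c h * V))" .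
    have "h * Z = (\<integral>b. indicator (shell h) b * ?D b + indicator (shell h) b * H b \<partial>lborel)"
      unfolding Z2 using h by (simp add: algebra_simps)
    also have "\<dots> = (\<integral>b. indicator (shell h) b * ?D b \<partial>lborel) + c h * Y"
      unfolding shell_H[OF h(1), symmetric] by (rule Bochner_Integration.integral_add[OF i4 i6])
    finally have "\<bar>h * Z - c h * Y\<bar> \<le> h * (K * norm y * (c h * V))" using e by simp
    moreover have "h * Z - c h * Y = h * (Z - c h / h * Y)" using h by (simp add: field_simps)
    ultimately have "h * \<bar>Z - c h / h * Y\<bar> \<le> h * (K * norm y * (c h * V))" using h by (simp add: abs_mult)
    then have "\<bar>Z - c h / h * Y\<bar> \<le> K * norm y * (c h * V)" using h by simp
    moreover have "\<bar>X - w\<bar> \<le> \<bar>X - Z\<bar> + \<bar>Z - w\<bar>" for w by linarith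
    ultimately show ?thesis using XZ by (smt (verit))
  qed
  have t0: "t \<longlonglongrightarrow> 0" unfolding t_def using LIMSEQ_Suc[OF lim_1_over_n] by simp
  have "((\<lambda>h::real. (1 + h) ^ DIM('x)) has_field_derivative real DIM('x)) (at 0)"
    by (auto intro!: derivative_eq_intros)
  then have "((\<lambda>h. c h / h) \<longlongrightarrow> real DIM('x)) (at 0)"
    by (simp add: DERIV_def c_def)
  moreover have "filterlim t (at 0) sequentially"
    unfolding filterlim_at using t0 by (auto simp: t_def)
  ultimately have ct: "(\<lambda>n. c (t n) / t n) \<longlonglongrightarrow> real DIM('x)"
    by (rule filterlim_compose)
  \<comment> \<open>The limit, left unevaluated, is 0: the shell volume vanishes with h.\<close>
  have bound_lim: "(\<lambda>n. 2 * (K * norm y * (c (t n) * V))) \<longlonglongrightarrow> 2 * (K * norm y * (((1 + 0) ^ DIM('x) - 1) * V))"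
    unfolding c_def by (intro tendsto_intros t0)
  have "(\<lambda>n. \<bar>X - c (t n) / t n * Y\<bar>) \<longlonglongrightarrow> \<bar>X - real DIM('x) * Y\<bar>"
    by (intro tendsto_intros ct)
  then have "\<bar>X - real DIM('x) * Y\<bar> \<le> 2 * (K * norm y * (((1 + 0) ^ DIM('x) - 1) * V))"
    by (rule LIMSEQ_le[OF _ bound_lim], intro exI[of _ 0] allI impI main) (simp_all add: t_def)
  then have XY: "X = real DIM('x) * Y" by simp
  have "(\<integral>s. F s * (s \<bullet> y) \<partial>uniform_sphere) = (\<integral>b. H b \<partial>uniform_measure lborel (cball 0 1))"
    unfolding uniform_sphere_def H_def by (rule integral_distr) auto
  also have "\<dots> = Y / V" unfolding Y_def V_def by (rule integral_uniform_ball) measurable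
  finally have "real DIM('x) * (\<integral>s. F s * (s \<bullet> y) \<partial>uniform_sphere) = X / V"
    by (simp add: XY)
  also have "\<dots> = (\<integral>b. G b \<bullet> y \<partial>uniform_measure lborel (cball 0 1))"
    unfolding X_def V_def by (rule integral_uniform_ball[symmetric]) measurable
  finally show ?thesis .
qed

text \<open>The linear function with gradient y has a constant right-hand side in
  \<open>ball_divergence\<close>.\<close>

lemma integral_sphere_inner_square:
  "real DIM('x) * (\<integral>s. (s \<bullet> y)\<^sup>2 \<partial>(uniform_sphere :: 'x::euclidean_space measure)) = (norm y)\<^sup>2"
proof -
  interpret prob_space "uniform_measure lborel (cball (0::'x) 1)" by (rule prob_space_uniform_ball)
  have "GDERIV (\<lambda>x. x \<bullet> y) x :> y" for x :: 'x
    unfolding gderiv_def by (auto intro!: derivative_eq_intros)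
  from ball_divergence[OF this, of y] show ?thesis using prob_space by (simp add: power2_eq_square dot_square_norm)
qed

text \<open>The integrand is odd, and scaling by -1 preserves both the ball and the measure.\<close>

lemma integral_ball_inner:
  "(\<integral>b. v \<bullet> b \<partial>uniform_measure lborel (cball (0::'x::euclidean_space) 1)) = 0"
proof -
  let ?f = "\<lambda>b::'x. indicator (cball 0 1) b * (v \<bullet> b)"
  have "integral\<^sup>L lborel ?f = \<bar>- 1\<bar> ^ DIM('x) * (\<integral>b. ?f (- 1 *\<^sub>R b) \<partial>lborel)"
    by (rule lborel_integral_scale) auto
  also have "\<dots> = (\<integral>b. - ?f b \<partial>lborel)"
    by (simp, intro Bochner_Integration.integral_cong) (auto simp: indicator_def)
  finally have "integral\<^sup>L lborel ?f = 0" by simp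
  then show ?thesis by (subst integral_uniform_ball) auto
qed

lemma integrable_uniform_sphere:
  fixes f :: "'x::euclidean_space \<Rightarrow> real"
  assumes "f \<in> borel_measurable borel" "\<And>s. norm s \<le> 1 \<Longrightarrow> \<bar>f s\<bar> \<le> K"
  shows "integrable uniform_sphere f"
proof -
  interpret prob_space "uniform_sphere :: 'x measure" by (rule prob_space_uniform_sphere)
  show ?thesis
  proof (rule integrable_const_bound[where B = K])
    show "AE s in uniform_sphere. norm (f s) \<le> K" using AE_uniform_sphere by eventually_elim (use assms in auto)
  qed (use assms in simp)
qed

lemma integrable_uniform_ball:
  fixes f :: "'x::euclidean_space \<Rightarrow> real"
  assumes "continuous_on UNIV f"
  shows "integrable (uniform_measure lborel (cball 0 1)) f"
proof -
  interpret prob_space "uniform_measure lborel (cball (0::'x) 1)" by (rule prob_space_uniform_ball)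
  have "compact (f ` cball 0 1)" using assms by (intro compact_continuous_image) (auto intro: continuous_on_subset)
  then obtain K where K: "\<forall>r\<in>f ` cball 0 1. norm r \<le> K" by (auto dest!: compact_imp_bounded simp only: bounded_iff)
  have f: "f \<in> borel_measurable borel" using assms by (rule borel_measurable_continuous_onI)
  show ?thesis
    by (rule integrable_const_bound[where B = K]) (use K f in \<open>auto intro!: AE_uniform_measureI\<close>)
qed

section \<open>Smooth functions convex near a minimum\<close>

locale smooth_function =
  fixes f :: "'x::euclidean_space \<Rightarrow> real" and grad :: "'x \<Rightarrow> 'x" and L :: real
  assumes gradient: "\<And>x. GDERIV f x :> grad x"
    and lipschitz: "\<And>x y. \<bar>f x - f y - grad y \<bullet> (x - y)\<bar> \<le> L / 2 * (norm (x - y))\<^sup>2"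
    and L_pos: "0 < L"
begin

text \<open>Its purpose is the continuity of \<open>grad\<close>, so the value of the constant is
  immaterial. The difference w of the gradients is tested at a point z displaced from x along w by
  the distance d of x and y. The quadratic bounds for the pairs (z, y), (z, x), (x, y) combine to
  isolate \<open>w \<bullet> (z - x)\<close>; their squared distances are at most 4, 1 and 1 times
  d^2, and half of the sum is 3.\<close>

lemma grad_lipschitz: "norm (grad x - grad y) \<le> 3 * L * norm (x - y)"
proof (cases "grad x = grad y \<or> x = y")
  case True
  then show ?thesis using L_pos by auto
next
  case False
  define d where "d = norm (x - y)"
  define w where "w = grad x - grad y"
  define z where "z = x + (d / norm w) *\<^sub>R w"
  have d: "0 < d" "0 < norm w" using False by (auto simp: d_def w_def)
  have zx: "norm (z - x) = d" using d by (simp add: z_def)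
  have "norm (z - y) \<le> norm (z - x) + norm (x - y)"
    using norm_triangle_ineq[of "z - x" "x - y"] by simp
  then have zy: "norm (z - y) \<le> 2 * d" using zx by (simp add: d_def)
  have zy2: "(norm (z - y))\<^sup>2 \<le> 4 * d\<^sup>2"
    using power_mono[OF zy norm_ge_zero, of 2] by (simp add: power_mult_distrib)
  have "w \<bullet> (z - x) = d * norm w"
    using d by (simp add: z_def dot_square_norm power2_eq_square)
  moreover have "w \<bullet> (z - x) = (f z - f y - grad y \<bullet> (z - y)) - (f z - f x - grad x \<bullet> (z - x))
      - (f x - f y - grad y \<bullet> (x - y))"
    by (simp add: w_def inner_diff_left inner_diff_right)
  ultimately have "d * norm w \<le> L / 2 * (norm (z - y))\<^sup>2 + L / 2 * (norm (z - x))\<^sup>2 + L / 2 * (norm (x - y))\<^sup>2"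
    using lipschitz[of z y] lipschitz[of z x] lipschitz[of x y] by linarith
  also have "\<dots> \<le> L / 2 * (4 * d\<^sup>2) + L / 2 * d\<^sup>2 + L / 2 * d\<^sup>2"
    using L_pos zy2 by (intro add_mono mult_left_mono) (auto simp: zx d_def)
  also have "\<dots> = d * (3 * L * d)" by (simp add: power2_eq_square)
  finally show ?thesis using d by (simp add: w_def d_def)
qed

lemma continuous_on_f: "continuous_on S f"
  by (rule GDERIV_continuous[OF gradient])

lemma continuous_on_grad: "continuous_on S grad"
proof (rule continuous_on_subset[OF _ subset_UNIV])
  have "(3 * L)-lipschitz_on UNIV grad"
    using grad_lipschitz L_pos by (auto simp: lipschitz_on_def dist_norm)
  then show "continuous_on UNIV grad" by (rule lipschitz_on_continuous_on)
qed

text \<open>Along the segment from x to z, convexity bounds f from above and the quadratic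
  inequality bounds it from below. After division by t the quadratic remainder vanishes as t tends
  to 0.\<close>

lemma tangent_below:
  assumes conv: "convex_on S f" and x: "x \<in> S" and z: "z \<in> S"
  shows "f x + grad x \<bullet> (z - x) \<le> f z"
proof -
  have "((\<lambda>t. grad x \<bullet> (z - x) - L / 2 * t * (norm (z - x))\<^sup>2) \<longlongrightarrow>
      grad x \<bullet> (z - x) - L / 2 * 0 * (norm (z - x))\<^sup>2) (at_right 0)"
    by (intro tendsto_intros)
  moreover have "\<forall>\<^sub>F t in at_right (0::real). grad x \<bullet> (z - x) - L / 2 * t * (norm (z - x))\<^sup>2 \<le> f z - f x"
    unfolding eventually_at_right_field
  proof (intro exI[of _ 1] conjI allI impI)
    fix t :: real assume t: "0 < t" "t < 1"
    have "f (x + t *\<^sub>R (z - x)) = f ((1 - t) *\<^sub>R x + t *\<^sub>R z)" by (simp add: algebra_simps)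
    also have "\<dots> \<le> (1 - t) * f x + t * f z" using t x z by (intro convex_onD[OF conv]) auto
    finally have "f (x + t *\<^sub>R (z - x)) \<le> (1 - t) * f x + t * f z" .
    moreover have "f (x + t *\<^sub>R (z - x)) - f x - t * (grad x \<bullet> (z - x)) \<ge> - (L / 2 * t\<^sup>2 * (norm (z - x))\<^sup>2)"
      using abs_le_D2[OF lipschitz[of "x + t *\<^sub>R (z - x)" x]] t by (simp add: power_mult_distrib mult.assoc)
    ultimately have "t * (grad x \<bullet> (z - x) - L / 2 * t * (norm (z - x))\<^sup>2) \<le> t * (f z - f x)"
      by (simp add: algebra_simps power2_eq_square)
    then show "grad x \<bullet> (z - x) - L / 2 * t * (norm (z - x))\<^sup>2 \<le> f z - f x" using t by simp
  qed simp
  ultimately have "grad x \<bullet> (z - x) - L / 2 * 0 * (norm (z - x))\<^sup>2 \<le> f z - f x"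
    by (intro tendsto_upperbound[where F = "at_right 0"]) auto
  then show ?thesis by simp
qed

lemma grad_local_min:
  assumes "\<forall>\<^sub>F z in nhds x. f x \<le> f z"
  shows "grad x = 0"
proof -
  have "(\<lambda>h. h \<bullet> grad x) = (\<lambda>h. 0)"
    by (rule has_derivative_local_min[of f])
       (use gradient[of x] assms in \<open>auto simp: gderiv_def eventually_at_filter elim: eventually_mono\<close>)
  then have "grad x \<bullet> grad x = 0" by metis
  then show ?thesis by simp
qed

end

locale smooth_convex_minimum = smooth_function f grad L
  for f :: "'x::euclidean_space \<Rightarrow> real" and grad L +
  fixes xs :: 'x and \<rho> :: real
  assumes local_min: "\<forall>\<^sub>F x in nhds xs. f xs \<le> f x"
    and convex: "convex_on (ball xs \<rho>) f"
    and \<rho>_pos: "0 < \<rho>"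
begin

lemma grad_xs: "grad xs = 0"
  using local_min by (rule grad_local_min)

text \<open>The gradient vanishes at the local minimum, so the tangent inequality there extends the
  minimality to the whole ball of convexity.\<close>

lemma f_min: "x \<in> ball xs \<rho> \<Longrightarrow> f xs \<le> f x"
  using tangent_below[OF convex, of xs x] \<rho>_pos by (simp add: grad_xs)

lemma f_upper: "f x \<le> f xs + L / 2 * (norm (x - xs))\<^sup>2"
  using abs_le_D1[OF lipschitz[of x xs]] by (simp add: grad_xs)

text \<open>A gradient step from \<open>x\<close> must not leave the ball, because \<open>f\<close> is only known to be at
  least \<open>f xs\<close> there; the step is cut at the length that preserves the distance to \<open>xs\<close>.\<close>

lemma grad_bound:
  assumes x: "x \<in> ball xs \<rho>"
  shows "(norm (grad x))\<^sup>2 \<le> 2 * L * (f x - f xs)"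
proof (cases "grad x = 0")
  case True
  then show ?thesis using f_min[OF x] L_pos by simp
next
  case False
  define a where "a = grad x \<bullet> (x - xs)"
  define G where "G = (norm (grad x))\<^sup>2"
  have G: "0 < G" using False by (simp add: G_def)
  have a: "f x - f xs \<le> a"
    using tangent_below[OF convex x, of xs] \<rho>_pos by (simp add: a_def inner_diff_right)
  have ge: "t * G - L / 2 * t\<^sup>2 * G \<le> f x - f xs" if t: "0 \<le> t" "t * G \<le> 2 * a" for t
  proof -
    let ?z = "x - t *\<^sub>R grad x"
    \<comment> \<open>The condition \<open>t * G \<le> 2 * a\<close> says exactly that a step of
      length t >= 0 does not increase the distance to \<open>xs\<close>.\<close>
    have "(norm (?z - xs))\<^sup>2 = (norm (x - xs))\<^sup>2 - t * (2 * a - t * G)"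
      unfolding G_def a_def dot_square_norm[symmetric]
      by (simp add: inner_diff_left inner_diff_right algebra_simps inner_commute power2_eq_square)
    also have "\<dots> \<le> (norm (x - xs))\<^sup>2" using t by simp
    finally have "norm (?z - xs) \<le> norm (x - xs)" by (simp add: power2_le_iff_abs_le)
    then have "?z \<in> ball xs \<rho>" using x by (simp add: dist_norm norm_minus_commute)
    then have "f xs \<le> f ?z" by (rule f_min)
    moreover have "f ?z - f x + t * G \<le> L / 2 * t\<^sup>2 * G"
      using abs_le_D1[OF lipschitz[of ?z x]] t by (simp add: G_def dot_square_norm power_mult_distrib)
    ultimately show ?thesis by simp
  qed
  have "0 \<le> a" using a f_min[OF x] by simp
  show ?thesis
  proof (cases "G \<le> 2 * a * L")
    \<comment> \<open>Here the usual step 1 / L is admissible.\<close>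
    case True
    then have "1 / L * G \<le> 2 * a" using L_pos by (simp add: field_simps)
    from ge[OF _ this] have "G / L - G / (2 * L) \<le> f x - f xs"
      using L_pos by (simp add: power2_eq_square)
    then show ?thesis using L_pos by (simp add: G_def[symmetric] field_simps)
  next
    case False
    \<comment> \<open>The longest admissible step, now shorter than 1 / L. If a were positive, it
      would lower f by more than a, although a bounds the gap \<open>f x - f xs\<close>. Hence a =
      0, so x is itself a minimum and its gradient vanishes, contrary to the case
      assumption.\<close>
    define t where "t = 2 * a / G"
    have tG: "t * G = 2 * a" using G by (simp add: t_def)
    have tL: "L * t < 1" using False G by (simp add: t_def field_simps)
    have "t * G * (1 - L * t / 2) \<le> f x - f xs"
      using ge[of t] tG G \<open>0 \<le> a\<close> by (simp add: t_def algebra_simps power2_eq_square)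
    then have "2 * a * (1 - L * t / 2) \<le> a" using a unfolding tG by linarith
    then have "a * (1 - L * t) \<le> 0" by (simp add: algebra_simps)
    then have "a = 0" using tL \<open>0 \<le> a\<close> by (simp add: mult_le_0_iff)
    then have fx: "f x = f xs" using a f_min[OF x] by simp
    have "\<forall>\<^sub>F z in nhds x. f x \<le> f z"
      unfolding fx eventually_nhds by (intro exI[of _ "ball xs \<rho>"]) (use x f_min in auto)
    then show ?thesis using \<open>grad x \<noteq> 0\<close> grad_local_min by blast
  qed
qed

text \<open>The estimator has mean the gradient of the average of \<open>f\<close> over a ball of radius \<open>\<mu>\<close>. Comparing
  these averages, instead of gradients, keeps the bias independent of the distance to \<open>xs\<close>.\<close>

lemma sphere_estimate_lower:
  assumes \<mu>: "0 < \<mu>" and x: "cball x \<mu> \<subseteq> ball xs \<rho>" and xs: "cball xs \<mu> \<subseteq> ball xs \<rho>"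
  shows "f x - f xs - L / 2 * \<mu>\<^sup>2
       \<le> real DIM('x) / \<mu> * (\<integral>s. (f (x + \<mu> *\<^sub>R s) - f x) * (s \<bullet> (x - xs)) \<partial>uniform_sphere)"
proof -
  let ?B = "uniform_measure lborel (cball (0::'x) 1)"
  interpret prob_space ?B by (rule prob_space_uniform_ball)
  note [continuous_intros] = continuous_on_compose2[OF continuous_on_f[of UNIV]]
    continuous_on_compose2[OF continuous_on_grad[of UNIV]]
  have "GDERIV (\<lambda>s. f (x + \<mu> *\<^sub>R s) - f x) s :> \<mu> *\<^sub>R grad (x + \<mu> *\<^sub>R s)" for s
  proof -
    have "(f has_derivative (\<lambda>h. h \<bullet> grad (x + \<mu> *\<^sub>R s))) (at (x + \<mu> *\<^sub>R s))"
      using gradient by (simp add: gderiv_def)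
    moreover have "((\<lambda>s. x + \<mu> *\<^sub>R s) has_derivative (\<lambda>h. \<mu> *\<^sub>R h)) (at s)"
      by (auto intro!: derivative_eq_intros)
    ultimately have "((\<lambda>s. f (x + \<mu> *\<^sub>R s)) has_derivative (\<lambda>h. (\<mu> *\<^sub>R h) \<bullet> grad (x + \<mu> *\<^sub>R s))) (at s)"
      by (rule has_derivative_compose[rotated])
    then show ?thesis unfolding gderiv_def by (auto intro!: derivative_eq_intros)
  qed
  from ball_divergence[OF this, of "x - xs"]
  have "real DIM('x) * (\<integral>s. (f (x + \<mu> *\<^sub>R s) - f x) * (s \<bullet> (x - xs)) \<partial>uniform_sphere)
      = \<mu> * (\<integral>b. grad (x + \<mu> *\<^sub>R b) \<bullet> (x - xs) \<partial>?B)"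
    by (simp add: continuous_intros)
  moreover have "f x - f xs - L / 2 * \<mu>\<^sup>2 \<le> (\<integral>b. grad (x + \<mu> *\<^sub>R b) \<bullet> (x - xs) \<partial>?B)"
  proof -
    have "measure ?B UNIV = 1" using prob_space by simp
    \<comment> \<open>The added linear term has mean 0 over the ball. It is needed because the
      tangent inequality at x produces it pointwise.\<close>
    then have "f x - f xs - L / 2 * \<mu>\<^sup>2 = (\<integral>b. (f x - f xs - L / 2 * \<mu>\<^sup>2) + (\<mu> *\<^sub>R grad x) \<bullet> b \<partial>?B)"
      by (subst Bochner_Integration.integral_add)
         (simp_all add: integrable_uniform_ball continuous_intros integral_ball_inner del: inner_scaleR_left)
    also have "\<dots> \<le> (\<integral>b. grad (x + \<mu> *\<^sub>R b) \<bullet> (x - xs) \<partial>?B)"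
    proof (rule integral_mono_AE)
      show "AE b in ?B. (f x - f xs - L / 2 * \<mu>\<^sup>2) + (\<mu> *\<^sub>R grad x) \<bullet> b \<le> grad (x + \<mu> *\<^sub>R b) \<bullet> (x - xs)"
      proof (rule AE_uniform_measureI[OF _ AE_I2[OF impI]])
        fix b :: 'x assume "b \<in> cball 0 1"
        then have "norm (\<mu> *\<^sub>R b) \<le> \<mu>" using \<mu> by simp
        then have "(norm (\<mu> *\<^sub>R b))\<^sup>2 \<le> \<mu>\<^sup>2" by (intro power_mono) auto
        then have sq: "L / 2 * (norm (\<mu> *\<^sub>R b))\<^sup>2 \<le> L / 2 * \<mu>\<^sup>2" using L_pos by (intro mult_left_mono) auto
        have in_ball: "x + \<mu> *\<^sub>R b \<in> ball xs \<rho>" "xs + \<mu> *\<^sub>R b \<in> ball xs \<rho>" "x \<in> ball xs \<rho>"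
          using \<open>norm (\<mu> *\<^sub>R b) \<le> \<mu>\<close> \<mu>
          by (intro subsetD[OF x] subsetD[OF xs]; simp add: dist_norm)+
        have "f x + grad x \<bullet> (\<mu> *\<^sub>R b) \<le> f (x + \<mu> *\<^sub>R b)"
          using tangent_below[OF convex in_ball(3,1)] by simp
        \<comment> \<open>The tangent at the shifted point is compared with the equally shifted
          \<open>xs\<close>, so that the displacement is exactly \<open>xs - x\<close>. The only
          cost is the value of f at the shifted \<open>xs\<close>, which exceeds \<open>f xs\<close>
          by at most L/2 times \<mu>^2.\<close>
        moreover have "f (x + \<mu> *\<^sub>R b) + grad (x + \<mu> *\<^sub>R b) \<bullet> (xs - x) \<le> f (xs + \<mu> *\<^sub>R b)"
          using tangent_below[OF convex in_ball(1,2)] by simp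
        moreover have "f (xs + \<mu> *\<^sub>R b) \<le> f xs + L / 2 * \<mu>\<^sup>2"
          using f_upper[of "xs + \<mu> *\<^sub>R b"] sq by simp
        ultimately show "(f x - f xs - L / 2 * \<mu>\<^sup>2) + (\<mu> *\<^sub>R grad x) \<bullet> b \<le> grad (x + \<mu> *\<^sub>R b) \<bullet> (x - xs)"
          by (simp add: inner_diff_right)
      qed simp
    qed (simp_all add: integrable_uniform_ball continuous_intros)
    finally show ?thesis .
  qed
  ultimately show ?thesis using \<mu> by simp
qed

end

section \<open>Randomised iterations\<close>

lemma sphere_history_insert:
  fixes F :: "(nat \<Rightarrow> 'x::euclidean_space) \<Rightarrow> real"
  assumes "integrable (history (Suc n)) F"
  shows "(\<integral>u. F u \<partial>history (Suc n)) = (\<integral>u. (\<integral>s. F (u(n := s)) \<partial>uniform_sphere) \<partial>history n)"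
proof -
  interpret prob_space "uniform_sphere :: 'x measure" by (rule prob_space_uniform_sphere)
  interpret product_sigma_finite "\<lambda>_::nat. uniform_sphere :: 'x measure" by standard
  show ?thesis
    using assms product_integral_insert[of "{..<n}" n F] by (simp add: history_def lessThan_Suc)
qed

lemma prob_space_history: "prob_space (history n :: (nat \<Rightarrow> 'x::euclidean_space) measure)"
  unfolding history_def by (intro prob_space_PiM prob_space_uniform_sphere)

locale random_iteration =
  fixes T :: "'x::euclidean_space \<Rightarrow> 'x \<Rightarrow> 'x" and x0 :: 'x and it :: "(nat \<Rightarrow> 'x) \<Rightarrow> nat \<Rightarrow> 'x"
  assumes it_0: "it u 0 = x0" and it_Suc: "it u (Suc k) = T (u k) (it u k)"
    and T_measurable: "(\<lambda>(s, x). T s x) \<in> borel_measurable (borel \<Otimes>\<^sub>M borel)"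
begin

lemma it_measurable: "k \<le> n \<Longrightarrow> (\<lambda>u. it u k) \<in> borel_measurable (history n)"
proof (induction k)
  case 0
  then show ?case by (simp add: it_0)
next
  case (Suc k)
  have [measurable]: "(\<lambda>u. it u k) \<in> borel_measurable (history n)" using Suc by simp
  have "(\<lambda>u. u k) \<in> measurable (history n) uniform_sphere"
    unfolding history_def using Suc by (intro measurable_component_singleton) auto
  then have [measurable]: "(\<lambda>u. u k) \<in> borel_measurable (history n)"
    by (simp cong: measurable_cong_sets)
  have "(\<lambda>u. (\<lambda>(s, x). T s x) (u k, it u k)) \<in> borel_measurable (history n)"
    by (rule measurable_compose[OF _ T_measurable]) measurable
  then show ?case by (simp add: it_Suc)
qed

text \<open>Iterate n is built from the directions 0, ..., n - 1, so redrawing direction n does not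
  affect it. This lets the newest direction be integrated with the past frozen.\<close>

lemma it_update: "k \<le> n \<Longrightarrow> it (u(n := s)) k = it u k"
  by (induction k) (simp_all add: it_0 it_Suc)

text \<open>Carrying the sum of past gains inside the integrand avoids conditional expectations: by
  Fubini the newest direction is integrated first, and the one-step hypothesis applies to that inner
  integral. The uniform bound K supplies all integrability.\<close>

lemma expected_descent:
  assumes x0: "x0 \<in> X" and T: "\<And>s x. T s x \<in> X"
    and V_meas [measurable]: "V \<in> borel_measurable borel" and a_meas [measurable]: "a \<in> borel_measurable borel"
    and V_bd: "\<And>x. x \<in> X \<Longrightarrow> \<bar>V x\<bar> \<le> K" and a_bd: "\<And>x. x \<in> X \<Longrightarrow> \<bar>a x\<bar> \<le> K"
    and descent: "\<And>x. x \<in> X \<Longrightarrow> (\<integral>s. V (T s x) \<partial>uniform_sphere) \<le> V x - a x + c"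
  shows "integrable (history n) (\<lambda>u. V (it u n) + (\<Sum>k<n. a (it u k)))"
    and "(\<integral>u. V (it u n) + (\<Sum>k<n. a (it u k)) \<partial>history n) \<le> V x0 + real n * c"
proof -
  have in_X: "it u k \<in> X" for u k by (cases k) (simp_all add: it_0 it_Suc x0 T)
  have int: "integrable (history n) (\<lambda>u. V (it u n) + (\<Sum>k<n. a (it u k)))" for n
  proof -
    interpret prob_space "history n :: (nat \<Rightarrow> 'x) measure" by (rule prob_space_history)
    note [measurable] = it_measurable[of _ n]
    show ?thesis
    proof (rule integrable_const_bound[where B = "K + real n * K"])
      show "AE u in history n. norm (V (it u n) + (\<Sum>k<n. a (it u k))) \<le> K + real n * K"
      proof (rule AE_I2)
        fix u
        have "\<bar>\<Sum>k<n. a (it u k)\<bar> \<le> (\<Sum>k<n. \<bar>a (it u k)\<bar>)" by (rule sum_abs)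
        also have "\<dots> \<le> real (card {..<n}) * K" by (rule sum_bounded_above) (use a_bd in_X in auto)
        finally show "norm (V (it u n) + (\<Sum>k<n. a (it u k))) \<le> K + real n * K"
          using V_bd[OF in_X, of u n] by simp
      qed
      have "(\<lambda>u. a (it u k)) \<in> borel_measurable (history n)" if "k < n" for k
        by (rule measurable_compose[OF it_measurable a_meas]) (use that in simp)
      moreover have "(\<lambda>u. V (it u n)) \<in> borel_measurable (history n)"
        by (rule measurable_compose[OF it_measurable V_meas]) simp
      ultimately show "(\<lambda>u. V (it u n) + (\<Sum>k<n. a (it u k))) \<in> borel_measurable (history n)"
        by (intro borel_measurable_add borel_measurable_sum) auto
    qed
  qed
  then show "integrable (history n) (\<lambda>u. V (it u n) + (\<Sum>k<n. a (it u k)))" .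
  show "(\<integral>u. V (it u n) + (\<Sum>k<n. a (it u k)) \<partial>history n) \<le> V x0 + real n * c"
  proof (induction n)
    case 0
    interpret prob_space "history 0 :: (nat \<Rightarrow> 'x) measure" by (rule prob_space_history)
    show ?case using prob_space by (simp add: it_0)
  next
    case (Suc n)
    interpret P: prob_space "history n :: (nat \<Rightarrow> 'x) measure" by (rule prob_space_history)
    interpret S: prob_space "uniform_sphere :: 'x measure" by (rule prob_space_uniform_sphere)
    let ?F = "\<lambda>m u. V (it u m) + (\<Sum>k<m. a (it u k))"
    have inner: "(\<integral>s. ?F (Suc n) (u(n := s)) \<partial>uniform_sphere) \<le> ?F n u + c" for u
    proof -
      have [measurable]: "(\<lambda>s. T s x) \<in> borel_measurable borel" for x
        using measurable_compose[OF measurable_Pair2'[of x borel borel] T_measurable] by simp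
      have iV: "integrable uniform_sphere (\<lambda>s. V (T s (it u n)))"
        by (rule integrable_uniform_sphere[where K = K]) (use V_bd T in auto)
      have "(\<integral>s. ?F (Suc n) (u(n := s)) \<partial>uniform_sphere)
          = (\<integral>s. V (T s (it u n)) + (\<Sum>k<Suc n. a (it u k)) \<partial>uniform_sphere)"
        by (simp add: it_Suc it_update)
      also have "\<dots> = (\<integral>s. V (T s (it u n)) \<partial>uniform_sphere) + (\<Sum>k<Suc n. a (it u k))"
        using iV S.prob_space by simp
      also have "\<dots> \<le> ?F n u + c" using descent[OF in_X, of u n] by simp
      finally show ?thesis .
    qed
    have "(\<integral>u. ?F (Suc n) u \<partial>history (Suc n)) = (\<integral>u. (\<integral>s. ?F (Suc n) (u(n := s)) \<partial>uniform_sphere) \<partial>history n)"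
      by (rule sphere_history_insert[OF int])
    also have "\<dots> \<le> (\<integral>u. ?F n u + c \<partial>history n)"
    proof (rule integral_mono)
      interpret product_sigma_finite "\<lambda>_::nat. uniform_sphere :: 'x measure" by standard
      show "integrable (history n) (\<lambda>u. \<integral>s. ?F (Suc n) (u(n := s)) \<partial>uniform_sphere)"
      proof (rule P.integrable_const_bound[where B = "K + real (Suc n) * K"])
        have [measurable]: "?F (Suc n) \<in> borel_measurable (Pi\<^sub>M (insert n {..<n}) (\<lambda>_. uniform_sphere))"
          using borel_measurable_integrable[OF int[of "Suc n"]] by (simp add: history_def lessThan_Suc)
        show "(\<lambda>u. \<integral>s. ?F (Suc n) (u(n := s)) \<partial>uniform_sphere) \<in> borel_measurable (history n)"
          unfolding history_def by measurable
        have bd: "norm (?F (Suc n) u) \<le> K + real (Suc n) * K" for u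
        proof -
          have "\<bar>\<Sum>k<Suc n. a (it u k)\<bar> \<le> (\<Sum>k<Suc n. \<bar>a (it u k)\<bar>)" by (rule sum_abs)
          also have "\<dots> \<le> real (card {..<Suc n}) * K" by (rule sum_bounded_above) (use a_bd in_X in auto)
          finally show ?thesis using V_bd[OF in_X, of u "Suc n"] by simp
        qed
        have "0 \<le> K" using V_bd[OF x0] by simp
        show "AE u in history n. norm (\<integral>s. ?F (Suc n) (u(n := s)) \<partial>uniform_sphere) \<le> K + real (Suc n) * K"
        proof (rule AE_I2)
          fix u
          have "norm (\<integral>s. ?F (Suc n) (u(n := s)) \<partial>uniform_sphere)
              \<le> (\<integral>s. norm (?F (Suc n) (u(n := s))) \<partial>uniform_sphere)" by (rule integral_norm_bound)
          also have "\<dots> \<le> K + real (Suc n) * K"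
          \<comment> \<open>A non-integrable slice has integral 0, so the bound holds without
            examining the measurability of slices.\<close>
          proof (cases "integrable uniform_sphere (\<lambda>s. norm (?F (Suc n) (u(n := s))))")
            case True
            then show ?thesis by (rule S.integral_le_const) (use bd in auto)
          next
            case False
            then show ?thesis using \<open>0 \<le> K\<close> by (simp add: not_integrable_integral_eq)
          qed
          finally show "norm (\<integral>s. ?F (Suc n) (u(n := s)) \<partial>uniform_sphere) \<le> K + real (Suc n) * K" .
        qed
      qed
      show "integrable (history n) (\<lambda>u. ?F n u + c)" using int[of n] by simp
    qed (rule inner)
    also have "\<dots> = (\<integral>u. ?F n u \<partial>history n) + c" using int[of n] P.prob_space by simp
    also have "\<dots> \<le> V x0 + real (Suc n) * c" using Suc.IH by (simp add: algebra_simps)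
    finally show ?case .
  qed
qed

end

context smooth_convex_minimum
begin

text \<open>Projection onto X does not increase the distance to \<open>xs\<close>. In the expanded
  square, the mean of the linear term gains 2 * \<gamma> times the gap \<open>f x - f xs\<close>, by
  \<open>sphere_estimate_lower\<close>. The gradient part of the second moment gives back 4 *
  \<gamma>^2 * m * L times the gap, by \<open>grad_bound\<close>; the choice of \<gamma> makes this
  \<gamma> / 2, leaving the factor 3/2.\<close>

lemma expected_distance:
  fixes f\<delta> :: "'x \<Rightarrow> real" and X :: "'x set"
  assumes X: "closed X" "convex X" "X \<noteq> {}" "xs \<in> X"
    and f\<delta>: "\<And>z. \<bar>f\<delta> z - f z\<bar> \<le> \<delta>" and [measurable]: "f\<delta> \<in> borel_measurable borel"
    and \<mu>: "0 < \<mu>" and \<gamma>: "\<gamma> = 1 / (8 * real DIM('x) * L)"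
    and x: "cball x \<mu> \<subseteq> ball xs \<rho>" and xs: "cball xs \<mu> \<subseteq> ball xs \<rho>" and far: "norm (x - xs) \<le> D"
  shows "(\<integral>s. (norm (closest_point X (x - \<gamma> *\<^sub>R gradient_estimate f\<delta> \<mu> x s) - xs))\<^sup>2 \<partial>uniform_sphere)
       \<le> (norm (x - xs))\<^sup>2 - 3 / 2 * \<gamma> * (f x - f xs)
          + \<gamma> * (L * \<mu>\<^sup>2 + 4 * (real DIM('x) / \<mu> * \<delta>) * D
                  + \<gamma> * ((real DIM('x) * L * \<mu>)\<^sup>2 + 16 * (real DIM('x) / \<mu> * \<delta>)\<^sup>2))"
proof -
  interpret prob_space "uniform_sphere :: 'x measure" by (rule prob_space_uniform_sphere)
  define m where "m = real DIM('x)"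
  define c where "c = m / \<mu>"
  define y where "y = x - xs"
  define \<Delta> where "\<Delta> = (\<lambda>s. f (x + \<mu> *\<^sub>R s) - f x)"
  define \<eta> where "\<eta> = (\<lambda>s. f\<delta> (x + \<mu> *\<^sub>R s) - f\<delta> x - \<Delta> s)"
  define g where "g = gradient_estimate f\<delta> \<mu> x"
  define z where "z = (\<lambda>s. closest_point X (x - \<gamma> *\<^sub>R g s))"
  have m: "0 < m" by (simp add: m_def)
  have c: "0 < c" using m \<mu> by (simp add: c_def)
  have \<gamma>_pos: "0 < \<gamma>" using m L_pos by (simp add: \<gamma> m_def)
  have D: "0 \<le> D" using far norm_ge_zero[of "x - xs"] by linarith
  have g: "g s = (c * (\<Delta> s + \<eta> s)) *\<^sub>R s" for s
    by (simp add: g_def gradient_estimate_def c_def m_def \<eta>_def)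
  have \<eta>: "\<bar>\<eta> s\<bar> \<le> 2 * \<delta>" for s
    using f\<delta>[of "x + \<mu> *\<^sub>R s"] f\<delta>[of x] by (simp add: \<eta>_def \<Delta>_def)
  have \<delta>: "0 \<le> \<delta>" using f\<delta>[of x] by simp
  have [measurable]: "f \<in> borel_measurable borel" "closest_point X \<in> borel_measurable borel"
    using continuous_on_f continuous_on_closest_point[OF X(2,1,3)] by (auto intro: borel_measurable_continuous_onI)
  have [measurable]: "\<Delta> \<in> borel_measurable borel" unfolding \<Delta>_def by measurable
  have [measurable]: "\<eta> \<in> borel_measurable borel" unfolding \<eta>_def by measurable
  have [measurable]: "g \<in> borel_measurable borel" unfolding g by measurable
  have [measurable]: "z \<in> borel_measurable borel" unfolding z_def by measurable
  define E where "E = m\<^sup>2 * L\<^sup>2 * \<mu>\<^sup>2 + 16 * c\<^sup>2 * \<delta>\<^sup>2"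
  define rhs where "rhs = (\<lambda>s. (norm y)\<^sup>2 + 4 * \<gamma> * c * \<delta> * D + \<gamma>\<^sup>2 * E
      - 2 * \<gamma> * c * (\<Delta> s * (s \<bullet> y)) + 2 * \<gamma>\<^sup>2 * m\<^sup>2 * (s \<bullet> grad x)\<^sup>2)"
  have pointwise: "(norm (z s - xs))\<^sup>2 \<le> rhs s" if s: "norm s \<le> 1" for s
  proof -
    have "norm (z s - xs) \<le> norm (x - \<gamma> *\<^sub>R g s - xs)"
      using closest_point_lipschitz[OF X(2,1,3), of "x - \<gamma> *\<^sub>R g s" xs] X
      by (simp add: z_def dist_norm closest_point_self)
    then have "(norm (z s - xs))\<^sup>2 \<le> (norm (y - \<gamma> *\<^sub>R g s))\<^sup>2"
      by (intro power_mono) (simp_all add: y_def algebra_simps)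
    also have "\<dots> = (norm y)\<^sup>2 - 2 * \<gamma> * (g s \<bullet> y) + \<gamma>\<^sup>2 * (norm (g s))\<^sup>2"
      unfolding dot_square_norm[symmetric]
      by (simp add: inner_diff_left inner_diff_right inner_commute power2_eq_square)
    finally have 1: "(norm (z s - xs))\<^sup>2 \<le> (norm y)\<^sup>2 - 2 * \<gamma> * (g s \<bullet> y) + \<gamma>\<^sup>2 * (norm (g s))\<^sup>2" .
    have "\<bar>s \<bullet> y\<bar> \<le> 1 * D"
      using Cauchy_Schwarz_ineq2[of s y] mult_mono[OF s far] by (simp add: y_def)
    then have "\<bar>\<eta> s\<bar> * \<bar>s \<bullet> y\<bar> \<le> (2 * \<delta>) * (1 * D)"
      using \<eta>[of s] \<delta> by (intro mult_mono) auto
    then have "- (2 * \<delta> * D) \<le> \<eta> s * (s \<bullet> y)"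
      unfolding abs_mult[symmetric] by (auto dest: abs_le_D2)
    then have "\<gamma> * c * (\<Delta> s * (s \<bullet> y) - 2 * \<delta> * D) \<le> \<gamma> * c * (\<Delta> s * (s \<bullet> y) + \<eta> s * (s \<bullet> y))"
      using \<gamma>_pos c by (intro mult_left_mono) auto
    also have "\<dots> = \<gamma> * (g s \<bullet> y)" by (simp add: g algebra_simps)
    finally have 2: "2 * \<gamma> * c * (\<Delta> s * (s \<bullet> y)) - 4 * \<gamma> * c * \<delta> * D \<le> 2 * \<gamma> * (g s \<bullet> y)"
      by (simp add: algebra_simps)
    \<comment> \<open>\<open>e\<close> is the Taylor remainder of the exact difference and
      \<open>\<eta> s\<close> the noise of two inexact values. Separating the gradient term first
      gives it the weight 2 in the square, and the two small terms the weight 4.\<close>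
    define e where "e = \<Delta> s - \<mu> * (s \<bullet> grad x)"
    have "\<bar>e\<bar> \<le> L / 2 * (norm (\<mu> *\<^sub>R s))\<^sup>2"
      using lipschitz[of "x + \<mu> *\<^sub>R s" x] by (simp add: e_def \<Delta>_def inner_commute)
    also have "\<dots> \<le> L / 2 * \<mu>\<^sup>2"
      using L_pos \<mu> s by (intro mult_left_mono power_mono) (auto simp: mult_left_le)
    finally have e: "\<bar>e\<bar> \<le> L / 2 * \<mu>\<^sup>2" .
    have "(norm (g s))\<^sup>2 \<le> (c * (\<Delta> s + \<eta> s))\<^sup>2"
    proof -
      have "norm (g s) \<le> \<bar>c * (\<Delta> s + \<eta> s)\<bar>" using s by (simp add: g mult_left_le)
      then show ?thesis using power_mono[of "norm (g s)" "\<bar>c * (\<Delta> s + \<eta> s)\<bar>" 2] by simp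
    qed
    also have "\<dots> \<le> c\<^sup>2 * (2 * \<mu>\<^sup>2 * (s \<bullet> grad x)\<^sup>2 + L\<^sup>2 * (\<mu>\<^sup>2)\<^sup>2 + 16 * \<delta>\<^sup>2)"
    proof -
      have "(\<Delta> s + \<eta> s)\<^sup>2 \<le> 2 * (\<mu> * (s \<bullet> grad x))\<^sup>2 + 4 * e\<^sup>2 + 4 * (\<eta> s)\<^sup>2"
      proof -
        have "(p + q + r)\<^sup>2 \<le> 2 * p\<^sup>2 + 4 * q\<^sup>2 + 4 * r\<^sup>2" for p q r :: real
          using zero_le_power2[of "p - (q + r)"] zero_le_power2[of "q - r"]
          by (simp add: power2_eq_square algebra_simps)
        from this[of "\<mu> * (s \<bullet> grad x)" e "\<eta> s"] show ?thesis by (simp add: e_def)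
      qed
      moreover have "e\<^sup>2 \<le> (L / 2 * \<mu>\<^sup>2)\<^sup>2" using power_mono[OF e abs_ge_zero, of 2] by simp
      moreover have "(\<eta> s)\<^sup>2 \<le> (2 * \<delta>)\<^sup>2" using power_mono[OF \<eta>[of s] abs_ge_zero, of 2] by simp
      ultimately have "(\<Delta> s + \<eta> s)\<^sup>2 \<le> 2 * \<mu>\<^sup>2 * (s \<bullet> grad x)\<^sup>2 + L\<^sup>2 * (\<mu>\<^sup>2)\<^sup>2 + 16 * \<delta>\<^sup>2"
        by (simp add: power_mult_distrib power_divide)
      then show ?thesis by (simp add: power_mult_distrib mult_left_mono)
    qed
    also have "\<dots> = 2 * m\<^sup>2 * (s \<bullet> grad x)\<^sup>2 + E"
      using \<mu> by (simp add: c_def E_def field_simps power2_eq_square)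
    finally have "\<gamma>\<^sup>2 * (norm (g s))\<^sup>2 \<le> \<gamma>\<^sup>2 * (2 * m\<^sup>2 * (s \<bullet> grad x)\<^sup>2 + E)" by (intro mult_left_mono) auto
    with 1 2 show ?thesis unfolding rhs_def by (simp add: algebra_simps)
  qed
  have cs: "\<bar>s \<bullet> v\<bar> \<le> norm v" if "norm s \<le> 1" for s v :: 'x
    using Cauchy_Schwarz_ineq2[of s v] mult_right_mono[OF that, of "norm v"] by simp
  have i1: "integrable uniform_sphere (\<lambda>s. \<Delta> s * (s \<bullet> y))"
  proof -
    have "compact (\<Delta> ` cball 0 1)"
      unfolding \<Delta>_def
      by (intro compact_continuous_image continuous_intros continuous_on_compose2[OF continuous_on_f[of UNIV]]) auto
    then obtain K where K: "\<forall>r\<in>\<Delta> ` cball 0 1. norm r \<le> K" by (auto dest!: compact_imp_bounded simp only: bounded_iff)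
    show ?thesis
    proof (rule integrable_uniform_sphere[where K = "K * norm y"])
      fix s :: 'x assume s: "norm s \<le> 1"
      then have "\<bar>\<Delta> s\<bar> \<le> K" using K by auto
      with cs[OF s, of y] show "\<bar>\<Delta> s * (s \<bullet> y)\<bar> \<le> K * norm y" unfolding abs_mult by (intro mult_mono) auto
    qed measurable
  qed
  have i2: "integrable uniform_sphere (\<lambda>s. (s \<bullet> grad x)\<^sup>2)"
  proof (rule integrable_uniform_sphere[where K = "(norm (grad x))\<^sup>2"])
    fix s :: 'x assume "norm s \<le> 1"
    from power_mono[OF cs[OF this, of "grad x"] abs_ge_zero, of 2]
    show "\<bar>(s \<bullet> grad x)\<^sup>2\<bar> \<le> (norm (grad x))\<^sup>2" by simp
  qed measurable
  have rhs_int: "integrable uniform_sphere rhs" unfolding rhs_def using i1 i2 by simp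
  define J where "J = (\<integral>s. \<Delta> s * (s \<bullet> y) \<partial>uniform_sphere)"
  have J: "f x - f xs - L / 2 * \<mu>\<^sup>2 \<le> c * J"
    using sphere_estimate_lower[OF \<mu> x xs] by (simp add: c_def m_def J_def \<Delta>_def y_def)
  have xb: "x \<in> ball xs \<rho>" using \<mu> by (intro subsetD[OF x]) simp
  \<comment> \<open>A random direction sees on average only the share 1/m of the squared gradient,
    which cancels one of the two factors m in the second moment.\<close>
  have sq: "m * (\<integral>s. (s \<bullet> grad x)\<^sup>2 \<partial>uniform_sphere) = (norm (grad x))\<^sup>2"
    unfolding m_def by (rule integral_sphere_inner_square)
  have "(\<integral>s. (norm (z s - xs))\<^sup>2 \<partial>uniform_sphere) \<le> (\<integral>s. rhs s \<partial>uniform_sphere)"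
  proof (rule integral_mono_AE[OF _ rhs_int])
    show ae: "AE s in uniform_sphere. (norm (z s - xs))\<^sup>2 \<le> rhs s"
      using AE_uniform_sphere by eventually_elim (rule pointwise)
    show "integrable uniform_sphere (\<lambda>s. (norm (z s - xs))\<^sup>2)"
      by (rule Bochner_Integration.integrable_bound[OF rhs_int])
         (use ae in \<open>auto elim!: eventually_mono\<close>)
  qed
  also have "\<dots> = (norm y)\<^sup>2 + 4 * \<gamma> * c * \<delta> * D + \<gamma>\<^sup>2 * E - 2 * \<gamma> * (c * J)
      + 2 * \<gamma>\<^sup>2 * m * (m * (\<integral>s. (s \<bullet> grad x)\<^sup>2 \<partial>uniform_sphere))"
    unfolding rhs_def J_def using i1 i2 prob_space by (simp add: power2_eq_square)
  also have "\<dots> \<le> (norm y)\<^sup>2 + 4 * \<gamma> * c * \<delta> * D + \<gamma>\<^sup>2 * E - 2 * \<gamma> * (f x - f xs - L / 2 * \<mu>\<^sup>2)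
      + 2 * \<gamma>\<^sup>2 * m * (2 * L * (f x - f xs))"
    unfolding sq using J \<gamma>_pos m c \<delta> grad_bound[OF xb]
    by (intro add_mono diff_mono mult_left_mono) auto
  also have "2 * \<gamma>\<^sup>2 * m * (2 * L * (f x - f xs)) = \<gamma> * (\<gamma> * (8 * m * L)) / 2 * (f x - f xs)"
    by (simp add: power2_eq_square)
  also have "\<gamma> * (8 * m * L) = 1" using m L_pos by (simp add: \<gamma> m_def)
  also have "(norm y)\<^sup>2 + 4 * \<gamma> * c * \<delta> * D + \<gamma>\<^sup>2 * E - 2 * \<gamma> * (f x - f xs - L / 2 * \<mu>\<^sup>2)
        + \<gamma> * 1 / 2 * (f x - f xs)
      = (norm y)\<^sup>2 - 3 / 2 * \<gamma> * (f x - f xs)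
        + \<gamma> * (L * \<mu>\<^sup>2 + 4 * (c * \<delta>) * D + \<gamma> * ((m * L * \<mu>)\<^sup>2 + 16 * (c * \<delta>)\<^sup>2))"
    by (simp add: E_def field_simps power2_eq_square)
  finally show ?thesis by (simp add: z_def g_def y_def c_def m_def)
qed

end

section \<open>Truncation of the PageRank series\<close>

locale pagerank_query =
  fixes I :: "('q, 'v, 'a, 'b) pagerank_problem" and q :: 'q
  assumes model: "pagerank_model I" and q: "q \<in> queries I"
begin

abbreviation "V \<equiv> vertices I q"
abbreviation "\<alpha> \<equiv> damping I"
abbreviation "T \<equiv> transition_transpose I q"

lemma damping: "0 < \<alpha>" "\<alpha> < 1"
  using model by (auto simp: pagerank_model_def)

lemma finite_V: "finite V" and edges_sub: "edges I q \<subseteq> V \<times> V"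
  and restart_nonneg: "i \<in> V \<Longrightarrow> 0 \<le> restart I q \<phi> i"
  and restart_sum: "(\<Sum>i\<in>V. restart I q \<phi> i) = 1"
  and transition_nonneg: "i' \<in> V \<Longrightarrow> i \<in> V \<Longrightarrow> 0 \<le> transition I q \<phi> i' i"
  and transition_row: "i' \<in> V \<Longrightarrow> (i', j) \<in> edges I q \<Longrightarrow> (\<Sum>i\<in>V. transition I q \<phi> i' i) = 1"
  using model q unfolding pagerank_model_def by blast+

lemma V_nonempty: "V \<noteq> {}"
  using restart_sum by force

text \<open>Vertices without out-edges have zero rows, so the matrix is only substochastic; that is
  enough for the l1 bound on its transpose.\<close>

lemma transition_row_le:
  assumes "i' \<in> V" shows "(\<Sum>i\<in>V. transition I q \<phi> i' i) \<le> 1"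
proof (cases "\<exists>j. (i', j) \<in> edges I q")
  case True
  then show ?thesis using transition_row[OF assms] by (metis order_refl)
next
  case False
  then show ?thesis by (simp add: transition_def)
qed

lemma transpose_outside: "i \<notin> V \<Longrightarrow> T \<phi> x i = 0"
  using edges_sub by (auto simp: transition_transpose_def transition_def intro!: sum.neutral)

lemma restart_outside: "i \<notin> V \<Longrightarrow> restart I q \<phi> i = 0"
  by (simp add: restart_def seeds_def)

lemma transpose_l1: "(\<Sum>i\<in>V. \<bar>T \<phi> x i\<bar>) \<le> (\<Sum>i\<in>V. \<bar>x i\<bar>)"
proof -
  have "(\<Sum>i\<in>V. \<bar>T \<phi> x i\<bar>) \<le> (\<Sum>i\<in>V. \<Sum>i'\<in>V. transition I q \<phi> i' i * \<bar>x i'\<bar>)"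
    unfolding transition_transpose_def
    by (intro sum_mono order_trans[OF sum_abs] sum_mono) (simp add: abs_mult transition_nonneg)
  also have "\<dots> = (\<Sum>i'\<in>V. (\<Sum>i\<in>V. transition I q \<phi> i' i) * \<bar>x i'\<bar>)"
    by (subst sum.swap) (simp add: sum_distrib_right)
  also have "\<dots> \<le> (\<Sum>i'\<in>V. 1 * \<bar>x i'\<bar>)"
    by (intro sum_mono mult_right_mono transition_row_le) auto
  finally show ?thesis by simp
qed

definition walk_term :: "'a \<times> 'b \<Rightarrow> nat \<Rightarrow> 'v \<Rightarrow> real" where
  "walk_term \<phi> n i = (1 - \<alpha>) ^ n * (T \<phi> ^^ n) (restart I q \<phi>) i"

lemma power_l1: "(\<Sum>i\<in>V. \<bar>(T \<phi> ^^ n) (restart I q \<phi>) i\<bar>) \<le> 1"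
proof (induction n)
  case 0
  have "(\<Sum>i\<in>V. \<bar>restart I q \<phi> i\<bar>) = (\<Sum>i\<in>V. restart I q \<phi> i)"
    by (intro sum.cong) (auto simp: restart_nonneg)
  then show ?case by (simp add: restart_sum)
next
  case (Suc n)
  then show ?case using transpose_l1[of \<phi> "(T \<phi> ^^ n) (restart I q \<phi>)"] by simp
qed

lemma walk_term_l1: "(\<Sum>i\<in>V. \<bar>walk_term \<phi> n i\<bar>) \<le> (1 - \<alpha>) ^ n"
proof -
  have "(\<Sum>i\<in>V. \<bar>walk_term \<phi> n i\<bar>) = (1 - \<alpha>) ^ n * (\<Sum>i\<in>V. \<bar>(T \<phi> ^^ n) (restart I q \<phi>) i\<bar>)"
    using damping by (simp add: walk_term_def abs_mult power_abs sum_distrib_left)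
  also have "\<dots> \<le> (1 - \<alpha>) ^ n * 1"
    using damping by (intro mult_left_mono power_l1) auto
  finally show ?thesis by simp
qed

lemma walk_term_outside: "i \<notin> V \<Longrightarrow> walk_term \<phi> n i = 0"
  by (cases n) (simp_all add: walk_term_def restart_outside transpose_outside)

lemma walk_term_abs_le: "\<bar>walk_term \<phi> n i\<bar> \<le> (1 - \<alpha>) ^ n"
proof (cases "i \<in> V")
  case True
  then have "\<bar>walk_term \<phi> n i\<bar> \<le> (\<Sum>i\<in>V. \<bar>walk_term \<phi> n i\<bar>)"
    by (intro member_le_sum) (auto simp: finite_V)
  then show ?thesis using walk_term_l1[of \<phi> n] by linarith
next
  case False
  then show ?thesis using damping by (simp add: walk_term_outside)
qed

lemma summable_geometric_damping: "summable (\<lambda>n. (1 - \<alpha>) ^ n)"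
  using damping by (intro summable_geometric) auto

lemma summable_abs_walk_term: "summable (\<lambda>n. \<bar>walk_term \<phi> n i\<bar>)"
  by (rule summable_comparison_test'[OF summable_geometric_damping, of 0]) (simp add: walk_term_abs_le)

lemma summable_walk_term: "summable (\<lambda>n. walk_term \<phi> n i)"
  using summable_abs_walk_term by (rule summable_rabs_cancel)

lemma walk_term_Suc: "walk_term \<phi> (Suc n) i = (1 - \<alpha>) * T \<phi> (walk_term \<phi> n) i"
  by (simp add: walk_term_def transition_transpose_def sum_distrib_left mult_ac)

definition neumann :: "'a \<times> 'b \<Rightarrow> 'v \<Rightarrow> real" where
  "neumann \<phi> i = \<alpha> * (\<Sum>n. walk_term \<phi> n i)"

text \<open>Applying the damped transpose termwise shifts the series by one index; the lost initial
  term is the restart vector.\<close>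

lemma neumann_fixpoint:
  "neumann \<phi> i = \<alpha> * restart I q \<phi> i + (1 - \<alpha>) * T \<phi> (neumann \<phi>) i"
proof -
  have "T \<phi> (neumann \<phi>) i = (\<Sum>i'\<in>V. \<alpha> * (\<Sum>n. transition I q \<phi> i' i * walk_term \<phi> n i'))"
    unfolding transition_transpose_def neumann_def suminf_mult[OF summable_walk_term] by (simp only: mult_ac)
  also have "\<dots> = \<alpha> * (\<Sum>n. \<Sum>i'\<in>V. transition I q \<phi> i' i * walk_term \<phi> n i')"
    by (subst suminf_sum) (auto simp: sum_distrib_left intro!: summable_mult summable_walk_term)
  finally have "(1 - \<alpha>) * T \<phi> (neumann \<phi>) i = \<alpha> * ((1 - \<alpha>) * (\<Sum>n. T \<phi> (walk_term \<phi> n) i))"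
    by (simp add: transition_transpose_def)
  also have "(1 - \<alpha>) * (\<Sum>n. T \<phi> (walk_term \<phi> n) i) = (\<Sum>n. walk_term \<phi> (Suc n) i)"
    unfolding walk_term_Suc transition_transpose_def
    by (intro suminf_mult[symmetric] summable_sum summable_mult summable_walk_term)
  also have "\<dots> = (\<Sum>n. walk_term \<phi> n i) - restart I q \<phi> i"
    using suminf_split_head[OF summable_walk_term, of \<phi> i] walk_term_def[of \<phi> 0 i] by simp
  finally have "(1 - \<alpha>) * T \<phi> (neumann \<phi>) i = neumann \<phi> i - \<alpha> * restart I q \<phi> i"
    by (simp only: neumann_def[of \<phi> i] right_diff_distrib)
  then show ?thesis by linarith
qed

text \<open>The definite description requires uniqueness: the difference of two solutions has an l1
  norm at most 1 - \<alpha> times itself.\<close>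

lemma pagerank_eq_neumann: "pagerank I q \<phi> = neumann \<phi>"
  unfolding pagerank_def
proof (rule the_equality)
  show "(\<forall>i. i \<notin> V \<longrightarrow> neumann \<phi> i = 0) \<and>
      (\<forall>i\<in>V. neumann \<phi> i = \<alpha> * restart I q \<phi> i + (1 - \<alpha>) * T \<phi> (neumann \<phi>) i)"
    using neumann_fixpoint by (auto simp: neumann_def walk_term_outside)
next
  fix x
  assume x: "(\<forall>i. i \<notin> V \<longrightarrow> x i = 0) \<and>
      (\<forall>i\<in>V. x i = \<alpha> * restart I q \<phi> i + (1 - \<alpha>) * T \<phi> x i)"
  define d where "d = (\<lambda>i. x i - neumann \<phi> i)"
  have Td: "T \<phi> d i = T \<phi> x i - T \<phi> (neumann \<phi>) i" for i
    by (simp add: d_def transition_transpose_def right_diff_distrib sum_subtractf)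
  have "d i = (1 - \<alpha>) * T \<phi> d i" if "i \<in> V" for i
  proof -
    have "x i = \<alpha> * restart I q \<phi> i + (1 - \<alpha>) * T \<phi> x i" using x that by blast
    with neumann_fixpoint[of \<phi> i] show ?thesis unfolding Td by (simp add: d_def algebra_simps)
  qed
  then have "(\<Sum>i\<in>V. \<bar>d i\<bar>) = (\<Sum>i\<in>V. \<bar>(1 - \<alpha>) * T \<phi> d i\<bar>)" by simp
  also have "\<dots> = (1 - \<alpha>) * (\<Sum>i\<in>V. \<bar>T \<phi> d i\<bar>)"
    using damping by (simp add: abs_mult sum_distrib_left)
  also have "\<dots> \<le> (1 - \<alpha>) * (\<Sum>i\<in>V. \<bar>d i\<bar>)"
    using damping by (intro mult_left_mono transpose_l1) auto
  finally have "\<alpha> * (\<Sum>i\<in>V. \<bar>d i\<bar>) \<le> 0" by (simp add: algebra_simps)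
  then have "(\<Sum>i\<in>V. \<bar>d i\<bar>) \<le> 0" using damping by (simp add: mult_le_0_iff)
  then have "(\<Sum>i\<in>V. \<bar>d i\<bar>) = 0" by (intro antisym sum_nonneg) auto
  then have "\<forall>i\<in>V. d i = 0" by (simp add: sum_nonneg_eq_0_iff finite_V)
  moreover have "d i = 0" if "i \<notin> V" for i
    using that x by (simp add: d_def neumann_def walk_term_outside)
  ultimately have "d i = 0" for i by blast
  then show "x = neumann \<phi>" by (auto simp: d_def fun_eq_iff)
qed

text \<open>The shift serves two uses: k = 0 bounds the mass of the PageRank vector, k = N + 1 the
  truncated tail.\<close>

lemma sum_suminf_term_le: "(\<Sum>i\<in>V. \<bar>\<Sum>n. walk_term \<phi> (n + k) i\<bar>) \<le> (1 - \<alpha>) ^ k / \<alpha>"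
proof -
  have sm: "summable (\<lambda>n. \<bar>walk_term \<phi> (n + k) i\<bar>)" for i
    using summable_abs_walk_term by (rule summable_ignore_initial_segment)
  have "(\<Sum>i\<in>V. \<bar>\<Sum>n. walk_term \<phi> (n + k) i\<bar>) \<le> (\<Sum>i\<in>V. \<Sum>n. \<bar>walk_term \<phi> (n + k) i\<bar>)"
    by (intro sum_mono summable_rabs sm)
  also have "\<dots> = (\<Sum>n. \<Sum>i\<in>V. \<bar>walk_term \<phi> (n + k) i\<bar>)"
    by (rule suminf_sum[symmetric]) (rule sm)
  also have "\<dots> \<le> (\<Sum>n. (1 - \<alpha>) ^ (n + k))"
    by (intro suminf_le walk_term_l1 summable_sum sm summable_ignore_initial_segment summable_geometric_damping)
  also have "\<dots> = (1 - \<alpha>) ^ k * (\<Sum>n. (1 - \<alpha>) ^ n)"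
    by (subst suminf_mult[OF summable_geometric_damping, symmetric]) (simp add: power_add mult.commute)
  also have "(\<Sum>n. (1 - \<alpha>) ^ n) = 1 / \<alpha>"
  proof -
    have "norm (1 - \<alpha>) < 1" using damping by auto
    from suminf_geometric[OF this] show ?thesis by simp
  qed
  finally show ?thesis by simp
qed

lemma pagerank_l1: "(\<Sum>i\<in>V. \<bar>pagerank I q \<phi> i\<bar>) \<le> 1"
proof -
  have "(\<Sum>i\<in>V. \<bar>pagerank I q \<phi> i\<bar>) = \<alpha> * (\<Sum>i\<in>V. \<bar>\<Sum>n. walk_term \<phi> (n + 0) i\<bar>)"
    using damping by (simp add: pagerank_eq_neumann neumann_def abs_mult sum_distrib_left)
  also have "\<dots> \<le> \<alpha> * ((1 - \<alpha>) ^ 0 / \<alpha>)"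
    using damping by (intro mult_left_mono sum_suminf_term_le) auto
  finally show ?thesis using damping by simp
qed

lemma sum_partial_term_le: "(\<Sum>i\<in>V. \<bar>\<Sum>n\<le>N. walk_term \<phi> n i\<bar>) \<le> (1 - (1 - \<alpha>) ^ (N + 1)) / \<alpha>"
proof -
  have "(\<Sum>i\<in>V. \<bar>\<Sum>n\<le>N. walk_term \<phi> n i\<bar>) \<le> (\<Sum>i\<in>V. \<Sum>n\<le>N. \<bar>walk_term \<phi> n i\<bar>)"
    by (intro sum_mono sum_abs)
  also have "\<dots> = (\<Sum>n\<le>N. \<Sum>i\<in>V. \<bar>walk_term \<phi> n i\<bar>)" by (rule sum.swap)
  also have "\<dots> \<le> (\<Sum>n\<le>N. (1 - \<alpha>) ^ n)" by (intro sum_mono walk_term_l1)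
  also have "\<dots> = (1 - (1 - \<alpha>) ^ (N + 1)) / \<alpha>"
    using damping by (simp add: sum_gp0)
  finally show ?thesis .
qed

lemma approx_pagerank_eq:
  "approx_pagerank I N q \<phi> i = \<alpha> / (1 - (1 - \<alpha>) ^ (N + 1)) * (\<Sum>n\<le>N. walk_term \<phi> n i)"
  by (simp add: approx_pagerank_def walk_term_def)

lemma geometric_gap: "0 < 1 - (1 - \<alpha>) ^ (N + 1)" "0 \<le> (1 - \<alpha>) ^ (N + 1)"
  using damping power_strict_mono[of "1 - \<alpha>" 1 "N + 1"] by auto

lemma approx_pagerank_l1: "(\<Sum>i\<in>V. \<bar>approx_pagerank I N q \<phi> i\<bar>) \<le> 1"
proof -
  let ?c = "(1 - \<alpha>) ^ (N + 1)"
  have "(\<Sum>i\<in>V. \<bar>approx_pagerank I N q \<phi> i\<bar>) = \<alpha> / (1 - ?c) * (\<Sum>i\<in>V. \<bar>\<Sum>n\<le>N. walk_term \<phi> n i\<bar>)"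
    using damping geometric_gap[of N] unfolding approx_pagerank_eq abs_mult by (simp add: sum_distrib_left)
  also have "\<dots> \<le> \<alpha> / (1 - ?c) * ((1 - ?c) / \<alpha>)"
    using damping geometric_gap[of N] by (intro mult_left_mono sum_partial_term_le) auto
  also have "\<dots> = 1" using damping geometric_gap[of N] by simp
  finally show ?thesis .
qed

text \<open>Two errors of size (1 - \<alpha>)^(N+1) each: the renormalisation of the partial sum and
  the missing tail of the series.\<close>

lemma approx_pagerank_error:
  "(\<Sum>i\<in>V. \<bar>approx_pagerank I N q \<phi> i - pagerank I q \<phi> i\<bar>) \<le> 2 * (1 - \<alpha>) ^ (N + 1)"
proof -
  let ?c = "(1 - \<alpha>) ^ (N + 1)"
  let ?S = "\<lambda>i. \<Sum>n\<le>N. walk_term \<phi> n i" and ?R = "\<lambda>i. \<Sum>n. walk_term \<phi> (n + (N + 1)) i"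
  note gap = geometric_gap[of N]
  have "\<bar>approx_pagerank I N q \<phi> i - pagerank I q \<phi> i\<bar> \<le> \<alpha> * ?c / (1 - ?c) * \<bar>?S i\<bar> + \<alpha> * \<bar>?R i\<bar>" for i
  proof -
    have "pagerank I q \<phi> i = \<alpha> * (?S i + ?R i)"
      unfolding pagerank_eq_neumann neumann_def
      using suminf_split_initial_segment[OF summable_walk_term, of \<phi> i "N + 1"]
      by (simp add: lessThan_Suc_atMost)
    then have "approx_pagerank I N q \<phi> i - pagerank I q \<phi> i = \<alpha> * ?c / (1 - ?c) * ?S i - \<alpha> * ?R i"
      unfolding approx_pagerank_eq using gap by (simp add: divide_simps) (simp add: algebra_simps)
    also have "\<bar>\<dots>\<bar> \<le> \<bar>\<alpha> * ?c / (1 - ?c) * ?S i\<bar> + \<bar>\<alpha> * ?R i\<bar>" by (rule abs_triangle_ineq4)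
    finally show ?thesis using damping gap by (simp add: abs_mult)
  qed
  then have "(\<Sum>i\<in>V. \<bar>approx_pagerank I N q \<phi> i - pagerank I q \<phi> i\<bar>)
      \<le> (\<Sum>i\<in>V. \<alpha> * ?c / (1 - ?c) * \<bar>?S i\<bar> + \<alpha> * \<bar>?R i\<bar>)" by (rule sum_mono)
  also have "\<dots> = \<alpha> * ?c / (1 - ?c) * (\<Sum>i\<in>V. \<bar>?S i\<bar>) + \<alpha> * (\<Sum>i\<in>V. \<bar>?R i\<bar>)"
    by (simp add: sum.distrib sum_distrib_left)
  also have "\<dots> \<le> \<alpha> * ?c / (1 - ?c) * ((1 - ?c) / \<alpha>) + \<alpha> * (?c / \<alpha>)"
    using damping gap by (intro add_mono mult_left_mono sum_partial_term_le sum_suminf_term_le) auto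
  also have "\<dots> = 2 * ?c" using damping gap by simp
  finally show ?thesis .
qed

section \<open>Sensitivity of the loss to the PageRank vectors\<close>

lemma row_l1: "\<bar>\<Sum>i\<in>V. row_matrix \<rho> i * x i\<bar> \<le> (\<Sum>i\<in>V. \<bar>x i\<bar>)"
proof (rule order_trans[OF sum_abs sum_mono])
  show "\<bar>row_matrix \<rho> i * x i\<bar> \<le> \<bar>x i\<bar>" for i by (cases \<rho>) (simp add: row_matrix_def)
qed

text \<open>The difference of squares is factored. Each hinge is 1-Lipschitz in the l1 norm, and
  passing to the Euclidean norm over the rows costs the square root of their number; the same
  comparison bounds each factor of the sum.\<close>

lemma query_loss_diff:
  defines "hinges x \<equiv> L2_set (\<lambda>\<rho>. max ((\<Sum>i\<in>V. row_matrix \<rho> i * x i) + row_offset I \<rho>) 0) (loss_rows I q)"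
  assumes x: "(\<Sum>i\<in>V. \<bar>x i\<bar>) \<le> 1" and y: "(\<Sum>i\<in>V. \<bar>y i\<bar>) \<le> 1" and xy: "(\<Sum>i\<in>V. \<bar>x i - y i\<bar>) \<le> e"
  shows "\<bar>(hinges x)\<^sup>2 - (hinges y)\<^sup>2\<bar>
       \<le> e * sqrt (card (loss_rows I q)) * (2 * sqrt (card (loss_rows I q)) + 2 * L2_set (row_offset I) (loss_rows I q))"
proof -
  let ?A = "\<lambda>x \<rho>. \<Sum>i\<in>V. row_matrix \<rho> i * x i"
  let ?h = "\<lambda>x \<rho>. max (?A x \<rho> + row_offset I \<rho>) 0"
  let ?D = "loss_rows I q"
  define k where "k = sqrt (card ?D)"
  have const: "L2_set (\<lambda>_. c) ?D = k * c" if "0 \<le> c" for c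
    using that by (simp add: L2_set_def k_def real_sqrt_mult)
  have e0: "0 \<le> e" using order_trans[OF sum_nonneg xy] by simp
  have bd: "hinges x \<le> k + L2_set (row_offset I) ?D" if "(\<Sum>i\<in>V. \<bar>x i\<bar>) \<le> 1" for x
  proof -
    have "hinges x \<le> L2_set (\<lambda>\<rho>. 1 + \<bar>row_offset I \<rho>\<bar>) ?D"
      unfolding hinges_def
    proof (rule L2_set_mono)
      show "?h x \<rho> \<le> 1 + \<bar>row_offset I \<rho>\<bar>" for \<rho>
        using order_trans[OF row_l1 that, of \<rho>] by (simp add: max_def, linarith)
    qed simp
    also have "\<dots> \<le> L2_set (\<lambda>_. 1) ?D + L2_set (\<lambda>\<rho>. \<bar>row_offset I \<rho>\<bar>) ?D" by (rule L2_set_triangle_ineq)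
    finally show ?thesis by (simp add: const)  (simp add: L2_set_def)
  qed
  have diff: "hinges x \<le> hinges y + k * e" if xy: "(\<Sum>i\<in>V. \<bar>x i - y i\<bar>) \<le> e" for x y
  proof -
    have "hinges x \<le> L2_set (\<lambda>\<rho>. ?h y \<rho> + e) ?D"
      unfolding hinges_def
    proof (rule L2_set_mono)
      fix \<rho>
      have "?A x \<rho> - ?A y \<rho> = ?A (\<lambda>i. x i - y i) \<rho>" by (simp add: right_diff_distrib sum_subtractf)
      then have "?A x \<rho> - ?A y \<rho> \<le> e" using row_l1[of \<rho> "\<lambda>i. x i - y i"] xy by linarith
      then show "?h x \<rho> \<le> ?h y \<rho> + e" using e0 by (simp add: max_def)
    qed simp
    also have "\<dots> \<le> hinges y + L2_set (\<lambda>_. e) ?D" unfolding hinges_def by (rule L2_set_triangle_ineq)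
    finally show ?thesis using e0 by (simp add: const)
  qed
  have "\<bar>hinges x - hinges y\<bar> \<le> k * e"
    using diff[OF xy] diff[of y x] xy by (simp add: abs_le_iff abs_minus_commute)
  moreover have "hinges x + hinges y \<le> 2 * k + 2 * L2_set (row_offset I) ?D"
    using bd[OF x] bd[OF y] by simp
  moreover have "0 \<le> hinges x + hinges y" unfolding hinges_def by (simp add: L2_set_nonneg)
  moreover have "0 \<le> k * e" using e0 by (simp add: k_def)
  ultimately have "\<bar>hinges x - hinges y\<bar> * (hinges x + hinges y) \<le> k * e * (2 * k + 2 * L2_set (row_offset I) ?D)"
    by (intro mult_mono) auto
  moreover have "\<bar>(hinges x)\<^sup>2 - (hinges y)\<^sup>2\<bar> = \<bar>hinges x - hinges y\<bar> * (hinges x + hinges y)"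
    using \<open>0 \<le> hinges x + hinges y\<close> by (simp add: power2_eq_square square_diff_square_factored abs_mult)
  ultimately show ?thesis by (simp add: k_def mult_ac)
qed

section \<open>Cost of one matrix-vector product\<close>

lemma column_nonzeros_le_card: "column_nonzeros I q \<phi> \<le> card V"
  unfolding column_nonzeros_def using V_nonempty finite_V
  by (subst Max_le_iff) (auto intro!: card_mono)

lemma column_nonzeros_le: "column_nonzeros I q \<phi> \<le> max_sparsity I"
proof -
  have "finite (range (column_nonzeros I q))"
    by (rule finite_subset[of _ "{..card V}"]) (use column_nonzeros_le_card in auto)
  then have "column_nonzeros I q \<phi> \<le> Max (range (column_nonzeros I q))" by (intro Max_ge) auto
  also have "\<dots> \<le> max_sparsity I"
    unfolding max_sparsity_def using model q by (intro Max_ge) (auto simp: pagerank_model_def)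
  finally show ?thesis .
qed

lemma product_ops_le: "product_ops I q \<phi> \<le> max_sparsity I * max_vertices I"
proof -
  have "card V \<le> max_vertices I"
    unfolding max_vertices_def using model q by (intro Max_ge) (auto simp: pagerank_model_def)
  then show ?thesis unfolding product_ops_def using column_nonzeros_le by (intro mult_mono) auto
qed

end

text \<open>Since 1 - \<alpha> \<le> exp (- \<alpha>), the choice of N brings (1 - \<alpha>)^(N+1)
  below \<delta> divided by the constant under the logarithm.\<close>

lemma approx_objective_error:
  assumes model: "pagerank_model I" and \<delta>: "0 < \<delta>"
    and N: "1 / damping I * ln (2 * sqrt (2 * real (max_rows I)) *
              (2 * sqrt (2 * real (max_rows I)) + 2 * max_offset_norm I) / \<delta>) \<le> real N"
  shows "\<bar>approx_objective I N \<phi> - objective I \<phi>\<bar> \<le> \<delta>"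
proof -
  define r where "r = real (max_rows I)"
  define b where "b = max_offset_norm I"
  define \<alpha> where "\<alpha> = damping I"
  define c where "c = (1 - \<alpha>) ^ (N + 1)"
  define n where "n = card (queries I)"
  have fin: "finite (queries I)" "queries I \<noteq> {}" and \<alpha>: "0 < \<alpha>" "\<alpha> < 1"
    using model by (auto simp: pagerank_model_def \<alpha>_def)
  then have n: "0 < n" by (simp add: n_def card_gt_0_iff)
  have rq: "real (card (loss_rows I q)) \<le> r" and bq: "L2_set (row_offset I) (loss_rows I q) \<le> b"
    if "q \<in> queries I" for q
    using that fin by (auto simp: r_def b_def max_rows_def max_offset_norm_def intro!: Max_ge)
  have b0: "0 \<le> b" using bq fin L2_set_nonneg order_trans by blast
  have r0: "0 \<le> r" by (simp add: r_def)
  have c0: "0 \<le> c" using \<alpha> by (simp add: c_def)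
  let ?h = "\<lambda>x q. (L2_set (\<lambda>\<rho>. max ((\<Sum>i\<in>vertices I q. row_matrix \<rho> i * x i) + row_offset I \<rho>) 0) (loss_rows I q))\<^sup>2"
  let ?K = "2 * c * sqrt r * (2 * sqrt r + 2 * b)"
  have each: "\<bar>?h (approx_pagerank I N q \<phi>) q - ?h (pagerank I q \<phi>) q\<bar> \<le> ?K" if q: "q \<in> queries I" for q
  proof -
    interpret pagerank_query I q using model q by unfold_locales
    have "\<bar>?h (approx_pagerank I N q \<phi>) q - ?h (pagerank I q \<phi>) q\<bar>
        \<le> (2 * c) * sqrt (card (loss_rows I q)) * (2 * sqrt (card (loss_rows I q)) + 2 * L2_set (row_offset I) (loss_rows I q))"
      unfolding c_def \<alpha>_def by (intro query_loss_diff approx_pagerank_l1 pagerank_l1 approx_pagerank_error)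
    also have "\<dots> \<le> ?K"
      using c0 rq[OF q] bq[OF q] r0 by (intro mult_mono add_mono) (auto simp: L2_set_nonneg)
    finally show ?thesis .
  qed
  have "approx_objective I N \<phi> - objective I \<phi>
      = 1 / real n * (\<Sum>q\<in>queries I. ?h (approx_pagerank I N q \<phi>) q - ?h (pagerank I q \<phi>) q)"
    by (simp add: approx_objective_def objective_def loss_def n_def sum_subtractf right_diff_distrib)
  also have "\<bar>\<dots>\<bar> \<le> 1 / real n * (real n * ?K)"
  proof -
    have "\<bar>\<Sum>q\<in>queries I. ?h (approx_pagerank I N q \<phi>) q - ?h (pagerank I q \<phi>) q\<bar> \<le> (\<Sum>q\<in>queries I. ?K)"
      by (rule order_trans[OF sum_abs sum_mono]) (rule each)
    then show ?thesis unfolding abs_mult by (intro mult_mono) (auto simp: n_def)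
  qed
  also have "\<dots> = ?K" using n by simp
  also have "\<dots> \<le> \<delta>"
  \<comment> \<open>Without rows the logarithm has argument 0 and the hypothesis on N carries no
    information, but the error bound vanishes with \<open>sqrt r\<close>.\<close>
  proof (cases "r = 0")
    case True
    then show ?thesis using \<delta> by simp
  next
    case False
    \<comment> \<open>The constant under the logarithm. It has \<open>sqrt (2 * r)\<close> where the
      error bound obtained above has \<open>sqrt r\<close>, so it dominates that bound.\<close>
    define K0 where "K0 = 2 * sqrt (2 * r) * (2 * sqrt (2 * r) + 2 * b)"
    have K0: "0 < K0" using False r0 b0 by (simp add: K0_def add_pos_nonneg)
    have "ln (K0 / \<delta>) \<le> \<alpha> * real N"
      using N \<alpha> by (simp add: K0_def r_def b_def \<alpha>_def field_simps)
    also have "\<dots> \<le> \<alpha> * real (N + 1)" using \<alpha> by simp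
    finally have l: "- (\<alpha> * real (N + 1)) \<le> - ln (K0 / \<delta>)" by simp
    have "c \<le> exp (- \<alpha>) ^ (N + 1)"
      unfolding c_def using \<alpha> exp_ge_add_one_self[of "- \<alpha>"] by (intro power_mono) auto
    also have "\<dots> = exp (- (\<alpha> * real (N + 1)))" by (metis exp_of_nat_mult mult.commute mult_minus_right)
    also have "\<dots> \<le> exp (- ln (K0 / \<delta>))" using l by simp
    also have "\<dots> = \<delta> / K0" using K0 \<delta> by (simp add: exp_minus)
    finally have "c * K0 \<le> \<delta>" using K0 by (simp add: field_simps)
    moreover have "2 * sqrt r * (2 * sqrt r + 2 * b) \<le> K0"
      unfolding K0_def using r0 b0 by (intro mult_mono add_mono) auto
    then have "c * (2 * sqrt r * (2 * sqrt r + 2 * b)) \<le> c * K0" using c0 by (intro mult_left_mono)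
    ultimately show ?thesis by (simp add: mult_ac)
  qed
  finally show ?thesis .
qed

lemma borel_measurable_approx_objective:
  fixes I :: "('q, 'v, 'a :: euclidean_space, 'b :: euclidean_space) pagerank_problem"
  assumes "measurable_weights I" "pagerank_model I"
  shows "approx_objective I N \<in> borel_measurable borel"
proof -
  have [measurable]: "(fst :: 'a \<times> 'b \<Rightarrow> 'a) \<in> borel_measurable borel"
    "(snd :: 'a \<times> 'b \<Rightarrow> 'b) \<in> borel_measurable borel"
    by (auto intro!: borel_measurable_continuous_onI continuous_intros)
  have vw: "(\<lambda>\<phi>::'a \<times> 'b. vertex_weight I q (fst \<phi>) i) \<in> borel_measurable borel"
    if "q \<in> queries I" "i \<in> vertices I q" for q i
    using assms(1) that by (intro measurable_compose[of fst borel borel "\<lambda>x. vertex_weight I q x i"])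
      (auto simp: measurable_weights_def)
  have ew: "(\<lambda>\<phi>::'a \<times> 'b. edge_weight I q (snd \<phi>) e) \<in> borel_measurable borel"
    if "q \<in> queries I" "e \<in> edges I q" for q e
    using assms(1) that by (intro measurable_compose[of snd borel borel "\<lambda>x. edge_weight I q x e"])
      (auto simp: measurable_weights_def)
  have res: "(\<lambda>\<phi>. restart I q \<phi> i) \<in> borel_measurable borel" if "q \<in> queries I" for q i
    using that unfolding restart_def
    by (cases "i \<in> seeds I q") (auto intro!: borel_measurable_divide borel_measurable_sum vw simp: seeds_def)
  have tr: "(\<lambda>\<phi>. transition I q \<phi> i' i) \<in> borel_measurable borel" if "q \<in> queries I" for q i' i
    using that unfolding transition_def
    by (cases "(i', i) \<in> edges I q") (auto intro!: borel_measurable_divide borel_measurable_sum ew)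
  have pow: "(\<lambda>\<phi>. (transition_transpose I q \<phi> ^^ n) (restart I q \<phi>) i) \<in> borel_measurable borel"
    if q: "q \<in> queries I" for q n i
  proof (induction n arbitrary: i)
    case 0
    then show ?case using res[OF q] by simp
  next
    case (Suc n)
    then show ?case using tr[OF q] by (simp add: transition_transpose_def)
  qed
  have app: "(\<lambda>\<phi>. approx_pagerank I N q \<phi> i) \<in> borel_measurable borel" if "q \<in> queries I" for q i
    unfolding approx_pagerank_def using pow[OF that] by simp
  show ?thesis
    unfolding approx_objective_def[abs_def] loss_def L2_set_def
    by (intro borel_measurable_times borel_measurable_sum borel_measurable_power borel_measurable_max
        borel_measurable_add app borel_measurable_const measurable_compose[OF _ borel_measurable_sqrt])
qed

lemma objective_nonneg: "0 \<le> objective I \<phi>"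
  unfolding objective_def loss_def by (intro mult_nonneg_nonneg sum_nonneg) auto

section \<open>Accuracy and cost of the method\<close>

context smooth_convex_minimum
begin

text \<open>A lower bound for all the values lies below their average, which the summed descent
  controls. The total is at most \<gamma> * n * \<epsilon>: one quarter pays for the initial
  distance, three quarters for the errors. The factor 3/2 in front of the gap leaves slack.\<close>

lemma expected_best:
  fixes f\<delta> :: "'x \<Rightarrow> real" and it :: "(nat \<Rightarrow> 'x) \<Rightarrow> nat \<Rightarrow> 'x" and best :: "(nat \<Rightarrow> 'x) \<Rightarrow> real"
  assumes it_0: "\<And>u. it u 0 = \<xi>"
    and it_Suc: "\<And>u k. it u (Suc k)
      = closest_point (cball \<xi> (2 * R)) (it u k - \<gamma> *\<^sub>R gradient_estimate f\<delta> \<mu> (it u k) (u k))"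
    and f\<delta>: "\<And>z. \<bar>f\<delta> z - f z\<bar> \<le> \<delta>" and f\<delta>_meas: "f\<delta> \<in> borel_measurable borel"
    and \<mu>: "0 < \<mu>" and \<gamma>: "\<gamma> = 1 / (8 * real DIM('x) * L)" and R: "0 < R"
    and vicinity: "cball \<xi> (2 * R + \<mu>) \<subseteq> ball xs \<rho>" and radius: "norm (\<xi> - xs) \<le> R"
    and errors: "L * \<mu>\<^sup>2 + 4 * (real DIM('x) / \<mu> * \<delta>) * (3 * R)
      + \<gamma> * ((real DIM('x) * L * \<mu>)\<^sup>2 + 16 * (real DIM('x) / \<mu> * \<delta>)\<^sup>2) \<le> 3 / 4 * \<epsilon>"
    and n: "R\<^sup>2 \<le> \<gamma> * real n * (\<epsilon> / 4)" and \<epsilon>: "0 < \<epsilon>"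
    and best: "\<And>u k. k < n \<Longrightarrow> best u \<le> f (it u k)" and best_int: "integrable (history n) best"
  shows "(\<integral>u. best u \<partial>history n) - f xs \<le> \<epsilon>"
proof -
  define X where "X = cball \<xi> (2 * R)"
  have X: "closed X" "convex X" "X \<noteq> {}" using R by (auto simp: X_def)
  have xsX: "xs \<in> X" using radius R by (simp add: X_def dist_norm)
  have \<gamma>_pos: "0 < \<gamma>" using L_pos by (simp add: \<gamma>)
  define T where "T = (\<lambda>s x. closest_point X (x - \<gamma> *\<^sub>R gradient_estimate f\<delta> \<mu> x s))"
  have TX: "T s x \<in> X" for s x unfolding T_def by (rule closest_point_in_set[OF X(1,3)])
  have [measurable]: "f\<delta> \<in> borel_measurable borel" by (rule f\<delta>_meas)
  have [measurable]: "closest_point X \<in> borel_measurable borel"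
    using continuous_on_closest_point[OF X(2,1,3)] by (auto intro: borel_measurable_continuous_onI)
  have [measurable]: "f \<in> borel_measurable borel"
    using continuous_on_f by (auto intro: borel_measurable_continuous_onI)
  have "(\<lambda>(s, x). T s x) \<in> borel_measurable (borel \<Otimes>\<^sub>M borel)"
    unfolding T_def gradient_estimate_def by measurable
  then interpret random_iteration T \<xi> it
    by unfold_locales (simp_all add: it_0 it_Suc T_def X_def)
  \<comment> \<open>2 * R inside the feasible ball plus R from its centre to
    \<open>xs\<close>.\<close>
  have far: "norm (x - xs) \<le> 3 * R" if "x \<in> X" for x
    using that radius norm_triangle_ineq[of "x - \<xi>" "\<xi> - xs"]
    by (simp add: X_def dist_norm norm_minus_commute)
  \<comment> \<open>The estimator probes points up to \<mu> outside the feasible ball, and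
    \<open>vicinity\<close> reserves that margin.\<close>
  have near: "cball x \<mu> \<subseteq> ball xs \<rho>" if "x \<in> X" for x
  proof (rule order_trans[OF _ vicinity], rule subsetI)
    fix z assume "z \<in> cball x \<mu>"
    then show "z \<in> cball \<xi> (2 * R + \<mu>)"
      using that dist_triangle[of \<xi> z x] by (simp add: X_def)
  qed
  define V where "V = (\<lambda>x. (norm (x - xs))\<^sup>2)"
  define a where "a = (\<lambda>x. 3 / 2 * \<gamma> * (f x - f xs))"
  have "compact (a ` X)"
    unfolding a_def X_def by (intro compact_continuous_image continuous_intros continuous_on_f) auto
  then obtain K where K: "\<forall>r\<in>a ` X. norm r \<le> K" by (auto dest!: compact_imp_bounded simp only: bounded_iff)
  define K' where "K' = max K ((3 * R)\<^sup>2)"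
  have \<xi>: "\<xi> \<in> X" using R by (simp add: X_def)
  have V_bd: "\<bar>V x\<bar> \<le> K'" if "x \<in> X" for x
    using power_mono[OF far[OF that] norm_ge_zero, of 2] by (simp add: V_def K'_def)
  have a_bd: "\<bar>a x\<bar> \<le> K'" if "x \<in> X" for x
    using K that by (auto simp: K'_def le_max_iff_disj)
  have descent: "(\<integral>s. V (T s x) \<partial>uniform_sphere) \<le> V x - a x + \<gamma> * (3 / 4 * \<epsilon>)" if "x \<in> X" for x
  proof -
    have "(\<integral>s. V (T s x) \<partial>uniform_sphere) \<le> V x - a x + \<gamma> * (L * \<mu>\<^sup>2 + 4 * (real DIM('x) / \<mu> * \<delta>) * (3 * R)
        + \<gamma> * ((real DIM('x) * L * \<mu>)\<^sup>2 + 16 * (real DIM('x) / \<mu> * \<delta>)\<^sup>2))"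
      unfolding V_def T_def a_def
      by (rule expected_distance[OF X xsX f\<delta> f\<delta>_meas \<mu> \<gamma> near[OF that] near[OF xsX] far[OF that]])
    also have "\<dots> \<le> V x - a x + \<gamma> * (3 / 4 * \<epsilon>)"
      using errors \<gamma>_pos by (intro add_left_mono mult_left_mono) auto
    finally show ?thesis .
  qed
  have [measurable]: "V \<in> borel_measurable borel" "a \<in> borel_measurable borel"
    unfolding V_def a_def by measurable
  note pot = expected_descent[of X V a K' "\<gamma> * (3 / 4 * \<epsilon>)" n, OF \<xi> TX _ _ V_bd a_bd descent]
  interpret prob_space "history n :: (nat \<Rightarrow> 'x) measure" by (rule prob_space_history)
  have "3 / 2 * \<gamma> * real n * ((\<integral>u. best u \<partial>history n) - f xs)
      = (\<integral>u. 3 / 2 * \<gamma> * real n * (best u - f xs) \<partial>history n)"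
    using best_int prob_space by simp
  also have "\<dots> \<le> (\<integral>u. V (it u n) + (\<Sum>k<n. a (it u k)) \<partial>history n)"
  proof (rule integral_mono)
    fix u
    have "(\<Sum>k<n. 3 / 2 * \<gamma> * (best u - f xs)) \<le> (\<Sum>k<n. a (it u k))"
      unfolding a_def using best \<gamma>_pos by (intro sum_mono mult_left_mono) auto
    then show "3 / 2 * \<gamma> * real n * (best u - f xs) \<le> V (it u n) + (\<Sum>k<n. a (it u k))"
      by (simp add: V_def mult_ac add_increasing)
  qed (use best_int pot in auto)
  also have "\<dots> \<le> R\<^sup>2 + real n * (\<gamma> * (3 / 4 * \<epsilon>))"
    using pot(2) power_mono[OF radius norm_ge_zero, of 2] by (simp add: V_def)
  also have "\<dots> \<le> \<gamma> * real n * (\<epsilon> / 4) + real n * (\<gamma> * (3 / 4 * \<epsilon>))"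
    by (intro add_right_mono n)
  also have "\<dots> = \<gamma> * real n * \<epsilon>" by (simp add: field_simps)
  finally have "(\<gamma> * real n) * (3 / 2 * ((\<integral>u. best u \<partial>history n) - f xs)) \<le> (\<gamma> * real n) * \<epsilon>"
    by (simp add: mult_ac)
  \<comment> \<open>n = 0 would turn the hypothesis on n into R^2 \<le> 0.\<close>
  moreover have "0 < \<gamma> * real n"
    using n R \<epsilon> zero_less_power[OF R, of 2] \<gamma>_pos by (cases n) auto
  ultimately have "3 / 2 * ((\<integral>u. best u \<partial>history n) - f xs) \<le> \<epsilon>"
    by (rule mult_left_le_imp_le)
  then show ?thesis using \<epsilon> by simp
qed

end

text \<open>Smoothing costs \<epsilon>/4, the noise in the linear term 3/8 \<epsilon>, and the
  squared noise at most \<epsilon>/512, together below 3/4 \<epsilon>.\<close>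

lemma method_error_budget:
  fixes L R \<epsilon> :: real and m :: nat
  assumes pos: "0 < L" "0 < R" "0 < \<epsilon>" "0 < m" and small: "\<epsilon> \<le> L * R\<^sup>2"
  defines "\<mu> \<equiv> smoothing m L \<epsilon>" and "\<delta> \<equiv> noise_level m L R \<epsilon>" and "\<gamma> \<equiv> 1 / (8 * real m * L)"
  shows "L * \<mu>\<^sup>2 + 4 * (real m / \<mu> * \<delta>) * (3 * R)
      + \<gamma> * ((real m * L * \<mu>)\<^sup>2 + 16 * (real m / \<mu> * \<delta>)\<^sup>2) \<le> 3 / 4 * \<epsilon>"
proof -
  define n where "n = real m"
  have n: "1 \<le> n" using pos by (simp add: n_def)
  have \<mu>2: "\<mu>\<^sup>2 = 2 * \<epsilon> / (L * (n + 8))"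
    using pos n by (simp add: \<mu>_def smoothing_def n_def)
  have "\<epsilon> powr (3/2) = \<epsilon> * sqrt \<epsilon>"
    using pos powr_add[of \<epsilon> 1 "1/2"] by (simp add: powr_half_sqrt)
  \<comment> \<open>\<delta> is tuned so that the noise, amplified by m / \<mu>, is inversely
    proportional to R; multiplied by a distance of order R it is then a fixed share of
    \<epsilon>.\<close>
  then have noise: "n / \<mu> * \<delta> = \<epsilon> / (32 * R)"
    using pos n unfolding \<mu>_def \<delta>_def smoothing_def noise_level_def n_def[symmetric]
    by (simp add: real_sqrt_divide real_sqrt_mult divide_simps)
  have \<gamma>: "\<gamma> * (n * L * \<mu>)\<^sup>2 = n * \<epsilon> / (4 * (n + 8))"
    using pos n unfolding power_mult_distrib \<mu>2 \<gamma>_def n_def[symmetric]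
    by (simp add: divide_simps power2_eq_square)
  have "\<gamma> * (16 * (\<epsilon> / (32 * R))\<^sup>2) = \<epsilon> / 512 * (\<epsilon> / (n * (L * R\<^sup>2)))"
    using pos n unfolding \<gamma>_def n_def[symmetric] by (simp add: divide_simps power2_eq_square)
  \<comment> \<open>This is where \<epsilon> \<le> L R^2 enters.\<close>
  also have "\<dots> \<le> \<epsilon> / 512 * 1"
  proof (intro mult_left_mono)
    have "1 * (L * R\<^sup>2) \<le> n * (L * R\<^sup>2)" using n pos by (intro mult_right_mono) auto
    then have "\<epsilon> \<le> n * (L * R\<^sup>2)" using small by linarith
    then show "\<epsilon> / (n * (L * R\<^sup>2)) \<le> 1" using pos n by simp
  qed (use pos in simp)
  finally have last: "\<gamma> * (16 * (\<epsilon> / (32 * R))\<^sup>2) \<le> \<epsilon> / 512" by simp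
  have "L * \<mu>\<^sup>2 = 2 * \<epsilon> / (n + 8)" using pos n by (simp add: \<mu>2)
  \<comment> \<open>The summand 8 in the choice of \<mu> matches the 8 in \<gamma>: bias and
    second-moment error then add up to exactly \<epsilon>/4, in every dimension.\<close>
  moreover have "2 * \<epsilon> / (n + 8) + n * \<epsilon> / (4 * (n + 8)) = \<epsilon> / 4"
    using n by (simp add: divide_simps) (simp add: algebra_simps)
  moreover have "4 * (\<epsilon> / (32 * R)) * (3 * R) = 3 / 8 * \<epsilon>" using pos by simp
  ultimately show ?thesis
    using last pos \<gamma> unfolding n_def[symmetric] noise by (simp add: distrib_left)
qed

text \<open>The cost claim is split because the formula ignores rounding: the mean of the operations
  really performed is bounded by the charge at the rounded counts, and the formula is the same
  charge evaluated before rounding.\<close>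

theorem theorem2:
  fixes I :: "('q, 'v, real ^ 'm1, real ^ 'm2) pagerank_problem"
    and \<phi>0 \<phi>star :: "(real ^ 'm1) \<times> (real ^ 'm2)"
    and grad :: "(real ^ 'm1) \<times> (real ^ 'm2) \<Rightarrow> (real ^ 'm1) \<times> (real ^ 'm2)"
    and L R \<epsilon> \<rho> b :: real
    and m r p s :: nat
  assumes model: "pagerank_model I" "judgement_model I" "measurable_weights I"
    and m: "m = CARD('m1) + CARD('m2)"
    and r: "r = max_rows I"
    and b: "b = max_offset_norm I"
    and p: "p = max_vertices I"
    and s: "s = max_sparsity I"
    and pos: "L > 0" "R > 0" "\<epsilon> > 0"
    and gradient: "\<And>x. GDERIV (objective I) x :> grad x"
    and lipschitz: "\<And>x y. \<bar>objective I x - objective I y - grad y \<bullet> (x - y)\<bar>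
                             \<le> L / 2 * (norm (x - y))\<^sup>2"
    and local_min: "\<forall>\<^sub>F x in nhds \<phi>star. objective I \<phi>star \<le> objective I x"
    and convex: "convex_on (ball \<phi>star \<rho>) (objective I)"
    and vicinity: "cball \<phi>0 (2 * R + smoothing m L \<epsilon>) \<subseteq> ball \<phi>star \<rho>"
    and radius: "norm (\<phi>0 - \<phi>star) \<le> R"
  shows "(LINT u|history (outer_iterations m L R \<epsilon>). objective I (output_point I L R \<epsilon> \<phi>0 u))
           - objective I \<phi>star \<le> \<epsilon>
       \<and> (LINT u|history (outer_iterations m L R \<epsilon>). real (run_ops I L R \<epsilon> \<phi>0 u))
           \<le> charged_ops I (outer_iterations m L R \<epsilon>) (inner_iterations I m L R \<epsilon>)
       \<and> charged_ops I (outer_count m L R \<epsilon>) (inner_count I m L R \<epsilon>)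
           = 64 * real m * real p * real s * real (card (queries I))
             * (L * R\<^sup>2 / (damping I * \<epsilon>))
             * ln (4 * (2 * real r + b * sqrt (2 * real r)) *
                   (32 * real m * R * sqrt (L * (real m + 8)) / (\<epsilon> powr (3/2) * sqrt 2)))"
proof (intro conjI)
  define M where "M = outer_iterations m L R \<epsilon>"
  define N where "N = inner_iterations I m L R \<epsilon>"
  define \<mu> where "\<mu> = smoothing m L \<epsilon>"
  define \<delta> where "\<delta> = noise_level m L R \<epsilon>"
  define best where "best = (\<lambda>u. objective I (output_point I L R \<epsilon> \<phi>0 u))"
  have dim: "DIM((real ^ 'm1) \<times> (real ^ 'm2)) = m" by (simp add: m)
  have m0: "0 < m" by (simp add: m)
  have \<mu>: "0 < \<mu>" using pos by (simp add: \<mu>_def smoothing_def add_nonneg_pos)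
  have \<delta>: "0 < \<delta>" using pos m0 by (simp add: \<delta>_def noise_level_def add_nonneg_pos)
  have "\<phi>0 \<in> cball \<phi>0 (2 * R + \<mu>)" using pos \<mu> by simp
  then have "\<phi>0 \<in> ball \<phi>star \<rho>" using vicinity unfolding \<mu>_def by blast
  then have "0 < \<rho>" using zero_le_dist[of \<phi>star \<phi>0] by (simp del: zero_le_dist)
  then interpret smooth_convex_minimum "objective I" grad L \<phi>star \<rho>
    using gradient lipschitz pos local_min convex by unfold_locales auto
  interpret P: prob_space "history M :: (nat \<Rightarrow> (real ^ 'm1) \<times> (real ^ 'm2)) measure"
    by (rule prob_space_history)
  \<comment> \<open>The output is chosen among M + 1 iterates. Index 0 serves the case of coarse
    accuracy, the indices below M the averaging argument.\<close>
  have best_le: "best u \<le> objective I (iterate I L R \<epsilon> \<phi>0 u k)" if "k \<le> M" for u k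
    unfolding best_def output_point_def dim using that by (intro arg_min_least) (auto simp: M_def)
  \<comment> \<open>The integral of a non-integrable function is 0, and the objective is non-negative.\<close>
  have "(LINT u|history M. best u) - objective I \<phi>star \<le> \<epsilon>"
  proof (cases "integrable (history M) best")
    case False
    then show ?thesis using pos objective_nonneg[of I \<phi>star] by (simp add: not_integrable_integral_eq)
  next
    case True
    show ?thesis
    proof (cases "\<epsilon> \<le> L * R\<^sup>2")
      case False
      have "best u \<le> objective I \<phi>star + \<epsilon>" for u
      proof -
        have "best u \<le> objective I \<phi>0" using best_le[of 0 u] by simp
        also have "\<dots> \<le> objective I \<phi>star + L / 2 * (norm (\<phi>0 - \<phi>star))\<^sup>2" by (rule f_upper)
        also have "L / 2 * (norm (\<phi>0 - \<phi>star))\<^sup>2 \<le> L / 2 * R\<^sup>2"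
          using pos radius by (intro mult_left_mono power_mono) auto
        also have "\<dots> \<le> \<epsilon>" using False pos by simp
        finally show ?thesis by simp
      qed
      then have "(LINT u|history M. best u) \<le> objective I \<phi>star + \<epsilon>"
        by (intro P.integral_le_const True) auto
      then show ?thesis by simp
    next
      case small: True
      show ?thesis
      proof (rule expected_best[where it = "iterate I L R \<epsilon> \<phi>0" and \<xi> = \<phi>0 and R = R and \<mu> = \<mu> and \<delta> = \<delta>
            and f\<delta> = "approx_objective I N" and \<gamma> = "1 / (8 * real m * L)"])
        show "iterate I L R \<epsilon> \<phi>0 u (Suc k) = closest_point (cball \<phi>0 (2 * R))
           (iterate I L R \<epsilon> \<phi>0 u k - (1 / (8 * real m * L)) *\<^sub>R
              gradient_estimate (approx_objective I N) \<mu> (iterate I L R \<epsilon> \<phi>0 u k) (u k))" for u k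
          unfolding iterate.simps method_step_def dim N_def \<mu>_def by (rule refl)
        show "\<bar>approx_objective I N z - objective I z\<bar> \<le> \<delta>" for z
        proof (rule approx_objective_error[OF model(1) \<delta>])
          show "1 / damping I * ln (2 * sqrt (2 * real (max_rows I)) *
              (2 * sqrt (2 * real (max_rows I)) + 2 * max_offset_norm I) / \<delta>) \<le> real N"
            unfolding \<delta>_def N_def inner_iterations_def inner_count_def[symmetric] by (rule real_nat_ceiling_ge)
        qed
        show "approx_objective I N \<in> borel_measurable borel"
          by (rule borel_measurable_approx_objective[OF model(3,1)])
        show "1 / (8 * real m * L) = 1 / (8 * real DIM((real ^ 'm1) \<times> (real ^ 'm2)) * L)"
          by (simp only: dim)
        show "L * \<mu>\<^sup>2 + 4 * (real DIM((real ^ 'm1) \<times> (real ^ 'm2)) / \<mu> * \<delta>) * (3 * R)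
          + 1 / (8 * real m * L) * ((real DIM((real ^ 'm1) \<times> (real ^ 'm2)) * L * \<mu>)\<^sup>2
             + 16 * (real DIM((real ^ 'm1) \<times> (real ^ 'm2)) / \<mu> * \<delta>)\<^sup>2) \<le> 3 / 4 * \<epsilon>"
          unfolding dim \<mu>_def \<delta>_def by (rule method_error_budget) (use pos m0 small in auto)
        \<comment> \<open>The origin of the outer count: \<gamma> * M * \<epsilon> / 4 equals R^2 at
          M = 32 * m * L * R^2 / \<epsilon>, and rounding up keeps the inequality.\<close>
        have "outer_count m L R \<epsilon> \<le> real M"
          unfolding M_def outer_iterations_def by (rule real_nat_ceiling_ge)
        then show "R\<^sup>2 \<le> 1 / (8 * real m * L) * real M * (\<epsilon> / 4)"
          using pos m0 by (simp add: outer_count_def field_simps)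
      qed (use pos \<mu> vicinity radius True best_le in \<open>auto simp: \<mu>_def\<close>)
    qed
  qed
  then show "(LINT u|history (outer_iterations m L R \<epsilon>). objective I (output_point I L R \<epsilon> \<phi>0 u))
           - objective I \<phi>star \<le> \<epsilon>"
    by (simp only: M_def best_def)

  \<comment> \<open>The charge bounds the cost for every sequence of directions, so the bound on the
    mean is immediate.\<close>
  have ops: "real (run_ops I L R \<epsilon> \<phi>0 u) \<le> charged_ops I M N" for u
  proof -
    have product: "product_ops I q x \<le> s * p" if "q \<in> queries I" for q x
    proof -
      interpret pagerank_query I q using model that by unfold_locales
      show ?thesis unfolding s p by (rule product_ops_le)
    qed
    have "run_ops I L R \<epsilon> \<phi>0 u \<le> (\<Sum>k<M. \<Sum>q\<in>queries I. N * (s * p) + N * (s * p))"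
      unfolding run_ops_def Let_def dim M_def[symmetric] N_def[symmetric]
      by (intro sum_mono add_mono mult_left_mono product) auto
    then have "real (run_ops I L R \<epsilon> \<phi>0 u) \<le> real (\<Sum>k<M. \<Sum>q\<in>queries I. N * (s * p) + N * (s * p))"
      by (rule of_nat_mono)
    then show ?thesis by (simp add: charged_ops_def s p mult_ac)
  qed
  have "(LINT u|history M. real (run_ops I L R \<epsilon> \<phi>0 u)) \<le> charged_ops I M N"
  proof (cases "integrable (history M) (\<lambda>u. real (run_ops I L R \<epsilon> \<phi>0 u))")
    case True
    then show ?thesis using ops by (intro P.integral_le_const) auto
  next
    case False
    then show ?thesis by (simp add: not_integrable_integral_eq charged_ops_def)
  qed
  then show "(LINT u|history (outer_iterations m L R \<epsilon>). real (run_ops I L R \<epsilon> \<phi>0 u))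
           \<le> charged_ops I (outer_iterations m L R \<epsilon>) (inner_iterations I m L R \<epsilon>)"
    by (simp only: M_def N_def)

  \<comment> \<open>What remains is algebra at the unrounded counts; the 64 is the 32 of the outer
    count times the two vectors computed per query and iteration.\<close>
  have "2 * sqrt (2 * real r) * (2 * sqrt (2 * real r) + 2 * b) = 4 * (2 * real r + b * sqrt (2 * real r))"
    by (simp add: algebra_simps)
  then have "2 * sqrt (2 * real r) * (2 * sqrt (2 * real r) + 2 * b) / noise_level m L R \<epsilon>
      = 4 * (2 * real r + b * sqrt (2 * real r)) *
          (32 * real m * R * sqrt (L * (real m + 8)) / (\<epsilon> powr (3/2) * sqrt 2))"
    by (simp add: noise_level_def)
  then show "charged_ops I (outer_count m L R \<epsilon>) (inner_count I m L R \<epsilon>)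
           = 64 * real m * real p * real s * real (card (queries I))
             * (L * R\<^sup>2 / (damping I * \<epsilon>))
             * ln (4 * (2 * real r + b * sqrt (2 * real r)) *
                   (32 * real m * R * sqrt (L * (real m + 8)) / (\<epsilon> powr (3/2) * sqrt 2)))"
    unfolding charged_ops_def outer_count_def inner_count_def r[symmetric] b[symmetric] p[symmetric] s[symmetric]
    by (simp add: mult_ac)
qed

end
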